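(* Suppose that $G=A\wr\mathbb{Z}$ is the restricted wreath product, where $A$ is a finitely generated abelian group. Then $G$ satisfies property (LR) if and only if $A$ is semisimple.
   Context: A subgroup $H$ of a group $K$ is a retract of $K$ if there is a homomorphism $\rho: K \to H$ which restricts to the identity map on $H$. A subgroup $H$ of a group $G$ is a virtual retract of $G$ if there exists a subgroup $K \leqslant G$ with $|G:K|<\infty$, $H \subseteq K$, and $H$ a retract of $K$. A group $G$ has property (LR) if every finitely generated subgroup of $G$ is a virtual retract of $G$. For groups $A,B$, the restricted wreath product $A\wr B$ is the semidirect product $A^B\rtimes B$, where $A^B$ is the group of all functions $f:B\to A$ with finite support under pointwise multiplication, and $b\in B$ acts by $(bfb^{-1})(x)=f(xb)$ for all $x\in B$. An abelian group is called semisimple if it is the direct sum of cyclic groups of prime order (the primes may differ and may repeat). *)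

theory Defs
  imports "HOL-Algebra.Product_Groups" "HOL-Algebra.Elementary_Groups" "HOL-Computational_Algebra.Primes"
begin

definition fin_gen_subgroup :: "'a set \<Rightarrow> ('a, 'b) monoid_scheme \<Rightarrow> bool"
  where "fin_gen_subgroup H G \<longleftrightarrow> (\<exists>S. finite S \<and> S \<subseteq> carrier G \<and> H = generate G S)"

definition fin_gen_group :: "('a, 'b) monoid_scheme \<Rightarrow> bool"
  where "fin_gen_group G \<longleftrightarrow> group G \<and> fin_gen_subgroup (carrier G) G"

definition group_retract :: "'a set \<Rightarrow> ('a, 'b) monoid_scheme \<Rightarrow> bool"
  where "group_retract H K \<longleftrightarrow>
    subgroup H K \<and> (\<exists>\<rho> \<in> hom K (K\<lparr>carrier := H\<rparr>). \<forall>h\<in>H. \<rho> h = h)"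

text \<open>Finite index of \<open>K\<close> in \<open>G\<close> is expressed as finiteness of the set of cosets, since
  \<^const>\<open>card\<close> returns 0 on infinite sets.\<close>

definition virtual_retract :: "'a set \<Rightarrow> ('a, 'b) monoid_scheme \<Rightarrow> bool"
  where "virtual_retract H G \<longleftrightarrow>
    subgroup H G \<and>
    (\<exists>K. subgroup K G \<and> finite (rcosets\<^bsub>G\<^esub> K) \<and> H \<subseteq> K \<and> group_retract H (G\<lparr>carrier := K\<rparr>))"

definition property_LR :: "('a, 'b) monoid_scheme \<Rightarrow> bool"
  where "property_LR G \<longleftrightarrow>
    group G \<and> (\<forall>H. subgroup H G \<and> fin_gen_subgroup H G \<longrightarrow> virtual_retract H G)"

text \<open>\<open>\<phi> h\<close> is the automorphism of \<open>N\<close> by which \<open>h\<close> acts by left conjugation; the pair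
  \<open>(n, h)\<close> stands for the product \<open>n h\<close>.\<close>

definition semidirect_product ::
    "('n, 'c) monoid_scheme \<Rightarrow> ('h, 'd) monoid_scheme \<Rightarrow> ('h \<Rightarrow> 'n \<Rightarrow> 'n) \<Rightarrow> ('n \<times> 'h) monoid"
  where "semidirect_product N H \<phi> =
    \<lparr>carrier = carrier N \<times> carrier H,
     monoid.mult = (\<lambda>(m, g) (n, h). (m \<otimes>\<^bsub>N\<^esub> \<phi> g n, g \<otimes>\<^bsub>H\<^esub> h)),
     one = (\<one>\<^bsub>N\<^esub>, \<one>\<^bsub>H\<^esub>)\<rparr>"

text \<open>The base group of finitely supported functions from \<open>B\<close> to \<open>A\<close> is the direct sum
  \<^const>\<open>sum_group\<close> of copies of \<open>A\<close> indexed by \<open>B\<close>; its elements are extensional, i.e.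
  \<^const>\<open>undefined\<close> off the carrier of \<open>B\<close>, which is why the action is restricted.\<close>

definition restricted_wreath ::
    "('a, 'c) monoid_scheme \<Rightarrow> ('b, 'd) monoid_scheme \<Rightarrow> (('b \<Rightarrow> 'a) \<times> 'b) monoid"
  where "restricted_wreath A B =
    semidirect_product (sum_group (carrier B) (\<lambda>_. A)) B
      (\<lambda>b f. \<lambda>x\<in>carrier B. f (x \<otimes>\<^bsub>B\<^esub> b))"

text \<open>The summands are taken in the type \<open>'a\<close> and indexed by a subset of \<open>'a\<close>. This is no
  restriction: given an isomorphism from \<open>G\<close> to any direct sum of groups of prime order, each
  summand is isomorphic to a subgroup of \<open>G\<close>, and the choice of a non-identity element in each
  summand embeds the index set into \<open>G\<close> (see \<open>semisimple_groupI\<close> below). The index set may be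
  empty, so the trivial group is semisimple.\<close>

definition semisimple_group :: "('a, 'b) monoid_scheme \<Rightarrow> bool"
  where "semisimple_group G \<longleftrightarrow>
    comm_group G \<and>
    (\<exists>(I :: 'a set) (C :: 'a \<Rightarrow> 'a monoid).
       (\<forall>i\<in>I. group (C i) \<and> cyclic_group (C i) \<and> prime (order (C i))) \<and> G \<cong> sum_group I C)"

lemma action_sum_group:
  assumes "group A" "group B" "b \<in> carrier B" "f \<in> carrier (sum_group (carrier B) (\<lambda>_. A))"
  shows "(\<lambda>x\<in>carrier B. f (x \<otimes>\<^bsub>B\<^esub> b)) \<in> carrier (sum_group (carrier B) (\<lambda>_. A))"
proof -
  interpret A: group A by fact
  interpret B: group B by fact
  have f: "f \<in> carrier B \<rightarrow>\<^sub>E carrier A" "finite {i \<in> carrier B. f i \<noteq> \<one>\<^bsub>A\<^esub>}"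
    using assms by (auto simp: carrier_sum_group)
  have "{x \<in> carrier B. f (x \<otimes>\<^bsub>B\<^esub> b) \<noteq> \<one>\<^bsub>A\<^esub>}
      \<subseteq> (\<lambda>x. x \<otimes>\<^bsub>B\<^esub> inv\<^bsub>B\<^esub> b) ` {i \<in> carrier B. f i \<noteq> \<one>\<^bsub>A\<^esub>}"
  proof
    fix x assume "x \<in> {x \<in> carrier B. f (x \<otimes>\<^bsub>B\<^esub> b) \<noteq> \<one>\<^bsub>A\<^esub>}"
    then show "x \<in> (\<lambda>x. x \<otimes>\<^bsub>B\<^esub> inv\<^bsub>B\<^esub> b) ` {i \<in> carrier B. f i \<noteq> \<one>\<^bsub>A\<^esub>}"
      using assms(3) by (intro image_eqI[of _ _ "x \<otimes>\<^bsub>B\<^esub> b"]) (auto simp: B.m_assoc)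
  qed
  then have "finite {x \<in> carrier B. f (x \<otimes>\<^bsub>B\<^esub> b) \<noteq> \<one>\<^bsub>A\<^esub>}"
    using f(2) by (meson finite_imageI finite_subset)
  moreover have "{i \<in> carrier B. (\<lambda>x\<in>carrier B. f (x \<otimes>\<^bsub>B\<^esub> b)) i \<noteq> \<one>\<^bsub>A\<^esub>}
      = {x \<in> carrier B. f (x \<otimes>\<^bsub>B\<^esub> b) \<noteq> \<one>\<^bsub>A\<^esub>}" by auto
  ultimately show ?thesis
    using f(1) assms by (auto simp: carrier_sum_group PiE_iff)
qed

lemma group_restricted_wreath:
  assumes "group A" "group B"
  shows "group (restricted_wreath A B)"
proof -
  interpret A: group A by fact
  interpret B: group B by fact
  let ?N = "sum_group (carrier B) (\<lambda>_. A)"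
  let ?a = "\<lambda>b f. \<lambda>x\<in>carrier B. f (x \<otimes>\<^bsub>B\<^esub> b)"
  interpret N: group ?N using assms by simp
  have val: "f x \<in> carrier A" if "f \<in> carrier ?N" "x \<in> carrier B" for f x
    using that assms by (auto simp: carrier_sum_group)
  have ext: "(\<lambda>x\<in>carrier B. f x) = f" if "f \<in> carrier ?N" for f
    using that assms by (auto simp: carrier_sum_group PiE_iff extensional_restrict)
  note act = action_sum_group[OF assms]
  have cl: "(\<lambda>x\<in>carrier B. f x \<otimes>\<^bsub>A\<^esub> g x) \<in> carrier ?N" if "f \<in> carrier ?N" "g \<in> carrier ?N" for f g
    using N.m_closed[OF that] by simp
  have restr: "(\<lambda>x\<in>carrier B. f x \<otimes>\<^bsub>A\<^esub> ?a b g x) \<in> carrier ?N"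
    if "f \<in> carrier ?N" "g \<in> carrier ?N" "b \<in> carrier B" for f g b
    using cl[OF that(1) act[OF that(3,2)]] .
  show ?thesis
    unfolding restricted_wreath_def semidirect_product_def
  proof (rule groupI, goal_cases)
    case (1 x y) then show ?case using restr by auto
  next
    case 2 show ?case using N.one_closed by auto
  next
    case (3 x y z) then show ?case
      by (auto simp: B.m_assoc A.m_assoc val intro!: restrict_ext)
  next
    case (4 x) then show ?case
      by (auto simp: val ext cong: restrict_cong)
  next
    case (5 x)
    obtain f b where x: "x = (f, b)" "f \<in> carrier ?N" "b \<in> carrier B" using 5 by auto
    let ?g = "inv\<^bsub>?N\<^esub> (?a (inv\<^bsub>B\<^esub> b) f)"
    have "?a (inv\<^bsub>B\<^esub> b) f \<in> carrier ?N" using act x by blast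
    then have g: "?g \<in> carrier ?N" "?g \<otimes>\<^bsub>?N\<^esub> ?a (inv\<^bsub>B\<^esub> b) f = \<one>\<^bsub>?N\<^esub>"
      by (blast intro: N.inv_closed, blast intro: N.l_inv)
    show ?case
      by (rule bexI[of _ "(?g, inv\<^bsub>B\<^esub> b)"]) (use g x in auto)
  qed
qed

lemma restricted_wreath_conj:
  assumes "group A" "group B" "b \<in> carrier B" "f \<in> carrier (sum_group (carrier B) (\<lambda>_. A))"
  shows "(\<one>\<^bsub>sum_group (carrier B) (\<lambda>_. A)\<^esub>, b) \<otimes>\<^bsub>restricted_wreath A B\<^esub> (f, \<one>\<^bsub>B\<^esub>)
      \<otimes>\<^bsub>restricted_wreath A B\<^esub> inv\<^bsub>restricted_wreath A B\<^esub> (\<one>\<^bsub>sum_group (carrier B) (\<lambda>_. A)\<^esub>, b)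
    = (\<lambda>x\<in>carrier B. f (x \<otimes>\<^bsub>B\<^esub> b), \<one>\<^bsub>B\<^esub>)"
proof -
  interpret A: group A by fact
  interpret B: group B by fact
  let ?N = "sum_group (carrier B) (\<lambda>_. A)"
  interpret N: group ?N using assms by simp
  interpret W: group "restricted_wreath A B" using assms by (simp add: group_restricted_wreath)
  have val: "f x \<in> carrier A" if "x \<in> carrier B" for x
    using that assms by (auto simp: carrier_sum_group)
  have one: "(\<lambda>x\<in>carrier B. \<one>\<^bsub>A\<^esub>) \<in> carrier ?N" using N.one_closed by simp
  have "inv\<^bsub>restricted_wreath A B\<^esub> (\<one>\<^bsub>?N\<^esub>, b) = (\<one>\<^bsub>?N\<^esub>, inv\<^bsub>B\<^esub> b)"
    by (rule W.inv_equality)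
      (use assms one in \<open>auto simp: restricted_wreath_def semidirect_product_def intro!: restrict_ext\<close>)
  then show ?thesis
    using assms by (auto simp: restricted_wreath_def semidirect_product_def val intro!: restrict_ext)
qed

lemma transport_group:
  fixes f :: "'c \<Rightarrow> 'a"
  assumes "group G" "inj_on f (carrier G)"
  shows "\<exists>H :: 'a monoid. group H \<and> G \<cong> H"
proof -
  interpret group G by fact
  define H where "H = \<lparr>carrier = f ` carrier G,
    monoid.mult = (\<lambda>x y. f (inv_into (carrier G) f x \<otimes>\<^bsub>G\<^esub> inv_into (carrier G) f y)), one = f \<one>\<^bsub>G\<^esub>\<rparr>"
  have "f \<in> iso G H"
    using assms(2) by (auto simp: iso_def hom_def H_def bij_betw_def)
  then have "group (H\<lparr>one := f \<one>\<^bsub>G\<^esub>\<rparr>)" "G \<cong> H"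
    by (auto intro: iso_imp_img_group is_isoI)
  then show ?thesis by (intro exI[of _ H]) (auto simp: H_def)
qed

lemma sum_group_reindex:
  assumes g: "inj_on g I" and D: "\<And>i. i \<in> I \<Longrightarrow> group (D (g i))"
  shows "sum_group I (\<lambda>i. D (g i)) \<cong> sum_group (g ` I) D"
proof -
  let ?S = "sum_group I (\<lambda>i. D (g i))" and ?T = "sum_group (g ` I) D"
  let ?k = "inv_into I g"
  let ?h = "\<lambda>x. \<lambda>j\<in>g ` I. x (?k j)" and ?h' = "\<lambda>y. \<lambda>i\<in>I. y (g i)"
  have k: "\<And>i. i \<in> I \<Longrightarrow> ?k (g i) = i" using g by simp
  have S: "carrier ?S = {x \<in> \<Pi>\<^sub>E i\<in>I. carrier (D (g i)). finite {i \<in> I. x i \<noteq> \<one>\<^bsub>D (g i)\<^esub>}}"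
    using D by (intro carrier_sum_group) auto
  have T: "carrier ?T = {x \<in> \<Pi>\<^sub>E i\<in>g ` I. carrier (D i). finite {i \<in> g ` I. x i \<noteq> \<one>\<^bsub>D i\<^esub>}}"
    using D by (intro carrier_sum_group) auto
  have a: "?h x \<in> carrier ?T" if "x \<in> carrier ?S" for x
  proof -
    have "{j \<in> g ` I. ?h x j \<noteq> \<one>\<^bsub>D j\<^esub>} \<subseteq> g ` {i \<in> I. x i \<noteq> \<one>\<^bsub>D (g i)\<^esub>}"
      using k by auto
    moreover have "finite {i \<in> I. x i \<noteq> \<one>\<^bsub>D (g i)\<^esub>}" using that S by auto
    ultimately have "finite {j \<in> g ` I. ?h x j \<noteq> \<one>\<^bsub>D j\<^esub>}"
      by (meson finite_imageI finite_subset)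
    then show ?thesis using that S T k by (auto simp: PiE_iff)
  qed
  have b: "?h' y \<in> carrier ?S" if "y \<in> carrier ?T" for y
  proof -
    have "g ` {i \<in> I. ?h' y i \<noteq> \<one>\<^bsub>D (g i)\<^esub>} \<subseteq> {j \<in> g ` I. y j \<noteq> \<one>\<^bsub>D j\<^esub>}"
      by auto
    moreover have "finite {j \<in> g ` I. y j \<noteq> \<one>\<^bsub>D j\<^esub>}" using that T by auto
    ultimately have "finite (g ` {i \<in> I. ?h' y i \<noteq> \<one>\<^bsub>D (g i)\<^esub>})"
      by (rule finite_subset)
    then have "finite {i \<in> I. ?h' y i \<noteq> \<one>\<^bsub>D (g i)\<^esub>}"
      by (rule finite_imageD) (rule inj_on_subset[OF g], auto)
    then show ?thesis using that S T by (auto simp: PiE_iff)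
  qed
  have "bij_betw ?h (carrier ?S) (carrier ?T)"
  proof (rule bij_betw_byWitness[of _ ?h'])
    show "\<forall>x\<in>carrier ?S. ?h' (?h x) = x"
      using S k by (auto simp: PiE_iff extensional_def fun_eq_iff)
    show "\<forall>y\<in>carrier ?T. ?h (?h' y) = y"
      using T k by (auto simp: PiE_iff extensional_def fun_eq_iff)
  qed (use a b in auto)
  moreover have "?h \<in> hom ?S ?T"
    using a k by (auto simp: hom_def intro!: restrict_ext)
  ultimately have "?h \<in> iso ?S ?T" by (simp add: iso_def)
  then show ?thesis by (rule is_isoI)
qed

lemma semisimple_groupI:
  fixes G :: "('a, 'b) monoid_scheme" and I :: "'i set" and C :: "'i \<Rightarrow> 'c monoid"
  assumes G: "comm_group G"
    and C: "\<And>i. i \<in> I \<Longrightarrow> group (C i) \<and> cyclic_group (C i) \<and> prime (order (C i))"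
    and iso: "G \<cong> sum_group I C"
  shows "semisimple_group G"
proof -
  interpret G: comm_group G by fact
  let ?S = "sum_group I C"
  have S: "carrier ?S = {x \<in> \<Pi>\<^sub>E i\<in>I. carrier (C i). finite {i \<in> I. x i \<noteq> \<one>\<^bsub>C i\<^esub>}}"
    using C by (intro carrier_sum_group) auto
  have "group ?S" using C by simp
  then have "?S \<cong> G" using iso G.iso_sym by blast
  then obtain \<psi> where "\<psi> \<in> iso ?S G" by (auto simp: is_iso_def)
  then have \<psi>: "inj_on \<psi> (carrier ?S)" by (auto simp: iso_def bij_betw_def)
  define e where "e i x = (\<lambda>j\<in>I. if j = i then x else \<one>\<^bsub>C j\<^esub>)" for i x
  have one: "\<one>\<^bsub>C i\<^esub> \<in> carrier (C i)" if "i \<in> I" for i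
    using C[OF that] by (simp add: group.is_monoid monoid.one_closed)
  have e: "e i x \<in> carrier ?S" if "i \<in> I" "x \<in> carrier (C i)" for i x
  proof -
    have "{j \<in> I. e i x j \<noteq> \<one>\<^bsub>C j\<^esub>} \<subseteq> {i}" by (auto simp: e_def)
    then have "finite {j \<in> I. e i x j \<noteq> \<one>\<^bsub>C j\<^esub>}" by (meson finite.emptyI finite.insertI finite_subset)
    then show ?thesis using that one S by (auto simp: e_def)
  qed
  have ev: "e i x i = x" if "i \<in> I" for i x using that by (simp add: e_def)
  have "\<exists>D :: 'a monoid. group D \<and> C i \<cong> D" if i: "i \<in> I" for i
  proof (rule transport_group)
    show "group (C i)" using C i by blast
    show "inj_on (\<lambda>x. \<psi> (e i x)) (carrier (C i))"
      by (rule inj_onI) (metis \<psi> e ev i inj_onD)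
  qed
  then obtain D :: "'i \<Rightarrow> 'a monoid" where D: "\<And>i. i \<in> I \<Longrightarrow> group (D i) \<and> C i \<cong> D i"
    by metis
  have "\<exists>x \<in> carrier (C i). x \<noteq> \<one>\<^bsub>C i\<^esub>" if "i \<in> I" for i
  proof (rule ccontr)
    assume "\<not> ?thesis"
    then have "carrier (C i) = {\<one>\<^bsub>C i\<^esub>}" using one that by auto
    then have "order (C i) = 1" by (simp add: order_def)
    then show False using C that by fastforce
  qed
  then obtain x where x: "\<And>i. i \<in> I \<Longrightarrow> x i \<in> carrier (C i) \<and> x i \<noteq> \<one>\<^bsub>C i\<^esub>" by metis
  define g where "g i = \<psi> (e i (x i))" for i
  have g: "inj_on g I"
  proof (rule inj_onI)
    fix i j assume ij: "i \<in> I" "j \<in> I" "g i = g j"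
    then have eq: "e i (x i) = e j (x j)" using \<psi> e x by (auto simp: g_def dest: inj_onD)
    have "e j (x j) i = x i" using eq ev ij(1) by metis
    show "i = j"
    proof (rule ccontr)
      assume "i \<noteq> j"
      then have "e j (x j) i = \<one>\<^bsub>C i\<^esub>" using ij(1) by (simp add: e_def)
      then show False using \<open>e j (x j) i = x i\<close> x[OF ij(1)] by metis
    qed
  qed
  define E where "E a = D (inv_into I g a)" for a
  have E: "E (g i) = D i" if "i \<in> I" for i using that g by (simp add: E_def)
  have CE: "group (C i)" "group (E (g i))" "C i \<cong> E (g i)" if "i \<in> I" for i
    unfolding E[OF that] using C[OF that] D[OF that] by blast+
  have "?S \<cong> sum_group I (\<lambda>i. E (g i))"
    by (rule iso_sum_groupI) (fact CE)+
  also have "\<dots> \<cong> sum_group (g ` I) E"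
    by (rule sum_group_reindex[OF g]) (fact CE)
  finally have "G \<cong> sum_group (g ` I) E" by (rule iso_trans[OF iso])
  moreover have "group (E a) \<and> cyclic_group (E a) \<and> prime (order (E a))" if a: "a \<in> g ` I" for a
  proof -
    obtain i where i: "i \<in> I" "a = g i" using a by blast
    have "order (D i) = order (C i)"
      using D[OF i(1)] iso_same_card[of "C i" "D i"] unfolding order_def by metis
    moreover have "cyclic_group (D i)"
      using isomorphic_group_cyclicity[of "C i" "D i"] C[OF i(1)] D[OF i(1)] by blast
    moreover have "E a = D i" using E i by blast
    ultimately show ?thesis using C[OF i(1)] D[OF i(1)] by (simp only: simp_thms)
  qed
  ultimately show ?thesis unfolding semisimple_group_def using G
    by (intro conjI exI[of _ "g ` I"] exI[of _ E] ballI) blast+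
qed

end

theory Submission
  imports Defs "HOL-Algebra.Multiplicative_Group"
begin

text \<open>A finitely generated abelian group \<open>A\<close> is semisimple iff it is generated by finitely many
  elements of prime order, and this holds as soon as \<open>a\<^sup>p \<in> \<langle>a\<^bsup>p\<^sup>2\<^esup>\<rangle>\<close> for all \<open>a\<close> and all primes \<open>p\<close>.

  If the wreath product is (LR), put \<open>b = a\<^sup>p\<close> and retract a finite-index subgroup \<open>K\<close> onto
  \<open>\<langle>b\<rangle> \<wr> \<int>\<close>. By the pigeonhole principle \<open>K\<close> contains a quotient of two translates of \<open>a\<close>; its
  image centralises \<open>b\<close>, hence lies in the base group, and its \<open>p\<close>-th power is the corresponding
  quotient of translates of \<open>b\<close>. So \<open>b\<close> is a \<open>p\<close>-th power in \<open>\<langle>b\<rangle>\<close>.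

  Conversely, \<open>H\<close> is a virtual retract if it normalises a subgroup \<open>L\<close> with \<open>H \<inter> L = 1\<close> and
  \<open>H L\<close> of finite index. If \<open>H\<close> lies in the base group \<open>N\<close>, it is supported in a bounded interval,
  and \<open>L\<close> is generated by a large \<open>m \<in> \<int>\<close> and all \<open>f \<cdot> (mfm\<^bsup>-1\<^esup>)\<^bsup>-1\<^esup>\<close> with \<open>f \<in> N\<close>. Otherwise \<open>H\<close>
  projects onto \<open>m\<int>\<close> with \<open>m > 0\<close>; call \<open>e \<in> N\<close> a generator if it takes a single non-trivial
  value, of prime order and from a fixed finite generating set, at one of the positions
  \<open>0, \<dots>, m - 1\<close>. Choose a maximal set of generators spanning, under shifts by multiples of \<open>m\<close>,
  a submodule \<open>L\<close> that meets \<open>H\<close> trivially. By maximality every generator has a non-trivial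
  multiple in \<open>(H \<inter> N) L\<close>. Since a proper quotient of \<open>\<int>/p[x, x\<^bsup>-1\<^esup>]\<close> is finite, \<open>(H \<inter> N) L\<close> then
  has finite index in \<open>N\<close>.\<close>

section \<open>Subgroups and generation\<close>

lemma (in group) finite_rcosets_if_finite_transversal:
  assumes K: "subgroup K G" and F: "finite F" "F \<subseteq> carrier G"
    and cov: "\<And>g. g \<in> carrier G \<Longrightarrow> \<exists>k\<in>K. \<exists>f\<in>F. g = k \<otimes> f"
  shows "finite (rcosets K)"
proof -
  have "rcosets K \<subseteq> (\<lambda>f. K #> f) ` F"
  proof
    fix c assume "c \<in> rcosets K"
    then obtain g where g: "g \<in> carrier G" "c = K #> g" by (auto simp: RCOSETS_def)
    then obtain k f where kf: "k \<in> K" "f \<in> F" "g = k \<otimes> f" using cov by blast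
    have "K #> g = (K #> k) #> f"
      using kf F K by (simp add: coset_mult_assoc subgroup.mem_carrier subgroup.subset subsetD)
    also have "K #> k = K" using K kf by (simp add: coset_join2 subgroup.mem_carrier)
    finally show "c \<in> (\<lambda>f. K #> f) ` F" using g kf by blast
  qed
  then show ?thesis using F finite_surj by blast
qed

text \<open>\<open>K = H L\<close> is an internal semidirect product: a subgroup because
  \<open>H\<close> normalises \<open>L\<close>, with unique factorisation \<open>h l\<close> because
  the intersection is trivial. Projection to the factor \<open>h\<close> is the retraction, and
  \<open>F\<close> represents the cosets of \<open>K\<close>.\<close>

lemma (in group) virtual_retract_if_normalised_complement:
  assumes H: "subgroup H G" and L: "subgroup L G"
    and nrm: "\<And>h l. h \<in> H \<Longrightarrow> l \<in> L \<Longrightarrow> h \<otimes> l \<otimes> inv h \<in> L"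
    and triv: "H \<inter> L \<subseteq> {\<one>}"
    and F: "finite F" "F \<subseteq> carrier G"
    and cov: "\<And>g. g \<in> carrier G \<Longrightarrow> \<exists>h\<in>H. \<exists>l\<in>L. \<exists>f\<in>F. g = h \<otimes> l \<otimes> f"
  shows "virtual_retract H G"
proof -
  interpret H: subgroup H G by fact
  interpret L: subgroup L G by fact
  define K where "K = {h \<otimes> l | h l. h \<in> H \<and> l \<in> L}"
  have nrm': "inv h \<otimes> l \<otimes> h \<in> L" if "h \<in> H" "l \<in> L" for h l
    using nrm[of "inv h" l] that by simp
  have cancel: "x \<otimes> (inv x \<otimes> y) = y" "inv x \<otimes> (x \<otimes> y) = y"
    if "x \<in> carrier G" "y \<in> carrier G" for x y
    using that by (simp_all flip: m_assoc)
  have prod: "(h \<otimes> l) \<otimes> (h' \<otimes> l') = (h \<otimes> h') \<otimes> ((inv h' \<otimes> l \<otimes> h') \<otimes> l')"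
    if "h \<in> H" "l \<in> L" "h' \<in> H" "l' \<in> L" for h l h' l'
    using that by (simp add: m_assoc cancel)
  have K: "subgroup K G"
  proof
    show "K \<subseteq> carrier G" by (auto simp: K_def)
    show "\<one> \<in> K" unfolding K_def
      by (intro CollectI exI[of _ \<one>]) (simp add: H.one_closed L.one_closed)
    show "x \<otimes> y \<in> K" if xy: "x \<in> K" "y \<in> K" for x y
    proof -
      obtain h l h' l' where *: "h \<in> H" "l \<in> L" "x = h \<otimes> l" "h' \<in> H" "l' \<in> L" "y = h' \<otimes> l'"
        using xy by (auto simp: K_def)
      then have "x \<otimes> y = (h \<otimes> h') \<otimes> ((inv h' \<otimes> l \<otimes> h') \<otimes> l')" using prod by simp
      moreover have "h \<otimes> h' \<in> H" "(inv h' \<otimes> l \<otimes> h') \<otimes> l' \<in> L" using * nrm' by auto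
      ultimately show ?thesis unfolding K_def by blast
    qed
    show "inv x \<in> K" if x: "x \<in> K" for x
    proof -
      obtain h l where hl: "h \<in> H" "l \<in> L" "x = h \<otimes> l" using x by (auto simp: K_def)
      have "inv x = inv h \<otimes> (h \<otimes> inv l \<otimes> inv h)"
        using hl by (simp add: inv_mult_group m_assoc cancel)
      then show ?thesis unfolding K_def using hl nrm[of h "inv l"] by blast
    qed
  qed
  have uniq: "h = h'" if "h \<in> H" "l \<in> L" "h' \<in> H" "l' \<in> L" "h \<otimes> l = h' \<otimes> l'" for h l h' l'
  proof -
    have "inv h' \<otimes> h = l' \<otimes> inv l"
      using that by (metis H.mem_carrier L.mem_carrier inv_closed inv_solve_left' inv_solve_right m_assoc m_closed)
    moreover have "inv h' \<otimes> h \<in> H" "l' \<otimes> inv l \<in> L" using that by auto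
    ultimately have "inv h' \<otimes> h = \<one>" using triv by auto
    then show ?thesis using that by (metis H.mem_carrier inv_closed inv_equality inv_inv)
  qed
  define \<rho> where "\<rho> k = (THE h. h \<in> H \<and> (\<exists>l\<in>L. k = h \<otimes> l))" for k
  have \<rho>: "\<rho> (h \<otimes> l) = h" if "h \<in> H" "l \<in> L" for h l
    unfolding \<rho>_def by (rule the_equality) (use that uniq in blast)+
  have HK: "H \<subseteq> K"
  proof
    fix h assume "h \<in> H"
    then show "h \<in> K" unfolding K_def
      by (intro CollectI exI[of _ h] exI[of _ \<one>]) (simp add: L.one_closed)
  qed
  have "\<rho> \<in> hom (G\<lparr>carrier := K\<rparr>) (G\<lparr>carrier := K, carrier := H\<rparr>)"
  proof (rule homI; simp)
    show "\<rho> x \<in> H" if "x \<in> K" for x using that \<rho> by (auto simp: K_def)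
    show "\<rho> (x \<otimes> y) = \<rho> x \<otimes> \<rho> y" if "x \<in> K" "y \<in> K" for x y
    proof -
      obtain h l h' l' where *: "h \<in> H" "l \<in> L" "x = h \<otimes> l" "h' \<in> H" "l' \<in> L" "y = h' \<otimes> l'"
        using \<open>x \<in> K\<close> \<open>y \<in> K\<close> by (auto simp: K_def)
      then show ?thesis using prod[of h l h' l'] nrm'[of h' l] by (simp add: \<rho>)
    qed
  qed
  moreover have "\<rho> h = h" if "h \<in> H" for h
    using \<rho>[OF that L.one_closed] that by simp
  moreover have "subgroup H (G\<lparr>carrier := K\<rparr>)"
    using K H HK by (simp add: subgroup_incl)
  ultimately have "group_retract H (G\<lparr>carrier := K\<rparr>)"
    unfolding group_retract_def by (intro conjI bexI[of _ \<rho>]) simp_all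
  moreover have "finite (rcosets K)"
  proof (rule finite_rcosets_if_finite_transversal[OF K F])
    fix g assume "g \<in> carrier G"
    then obtain h l f where "h \<in> H" "l \<in> L" "f \<in> F" "g = h \<otimes> l \<otimes> f" using cov by blast
    then show "\<exists>k\<in>K. \<exists>f\<in>F. g = k \<otimes> f" unfolding K_def by blast
  qed
  ultimately show ?thesis unfolding virtual_retract_def using H K HK by blast
qed

lemma (in group) generate_finite_support:
  assumes "x \<in> generate G P"
  shows "\<exists>Q. finite Q \<and> Q \<subseteq> P \<and> x \<in> generate G Q"
  using assms
proof induction
  case one
  show ?case by (metis empty_subsetI finite.emptyI generate.one)
next
  case (incl h)
  then show ?case by (intro exI[of _ "{h}"]) (auto intro: generate.incl)
next
  case (inv h)
  then show ?case by (intro exI[of _ "{h}"]) (auto intro: generate.inv)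
next
  case (eng h1 h2)
  then obtain Q1 Q2 where "finite Q1" "Q1 \<subseteq> P" "h1 \<in> generate G Q1"
    "finite Q2" "Q2 \<subseteq> P" "h2 \<in> generate G Q2" by blast
  then show ?case
    by (intro exI[of _ "Q1 \<union> Q2"])
      (auto intro!: generate.eng intro: mono_generate[THEN subsetD, rotated])
qed

lemma (in comm_group) generate_Un_subgroup:
  assumes X: "X \<subseteq> carrier G" and H: "subgroup H G" and y: "y \<in> generate G (X \<union> H)"
  shows "\<exists>w\<in>generate G X. \<exists>u\<in>H. y = w \<otimes> u"
proof -
  have gX: "subgroup (generate G X) G" using X by (rule generate_is_subgroup)
  have "subgroup (generate G X <#> H) G" using gX H by (rule mult_subgroups)
  moreover have "X \<union> H \<subseteq> generate G X <#> H"
  proof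
    fix x assume x: "x \<in> X \<union> H"
    then have "x \<in> carrier G" using X subgroup.subset[OF H] by blast
    then have "x = x \<otimes> \<one>" "x = \<one> \<otimes> x" by simp_all
    then show "x \<in> generate G X <#> H" unfolding set_mult_def
      using x generate.one generate.incl subgroup.one_closed[OF H] by fastforce
  qed
  ultimately have "generate G (X \<union> H) \<subseteq> generate G X <#> H"
    by (rule generate_subgroup_incl[rotated])
  then show ?thesis using y unfolding set_mult_def by blast
qed

text \<open>Adjoining one element with trivial \<open>n\<close>-th power multiplies the index by at
  most \<open>n\<close>. So finitely many torsion elements enlarge \<open>B\<close> only by a finite
  index, and \<open>F\<close> consists of products of bounded powers of them.\<close>

lemma (in comm_group) generate_Un_finite_torsion:
  assumes "finite E" "E \<subseteq> carrier G" "\<And>e. e \<in> E \<Longrightarrow> \<exists>n>0. e [^] (n::nat) = \<one>"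
    and B: "subgroup B G"
  shows "\<exists>F. finite F \<and> F \<subseteq> carrier G \<and> (\<forall>x\<in>generate G (B \<union> E). \<exists>b\<in>B. \<exists>f\<in>F. x = b \<otimes> f)"
  using assms(1-3)
proof (induction E)
  case empty
  have "generate G B \<subseteq> B" using B by (simp add: generate_subgroup_incl)
  then show ?case using subgroup.mem_carrier[OF B] by (intro exI[of _ "{\<one>}"]) force
next
  case (insert e E)
  then obtain F where F: "finite F" "F \<subseteq> carrier G"
    and cov: "\<And>x. x \<in> generate G (B \<union> E) \<Longrightarrow> \<exists>b\<in>B. \<exists>f\<in>F. x = b \<otimes> f" by auto
  obtain n :: nat where n: "n > 0" "e [^] n = \<one>" using insert.prems by blast
  have e: "e \<in> carrier G" using insert.prems by simp
  have BE: "B \<union> E \<subseteq> carrier G" using insert.prems subgroup.subset[OF B] by auto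
  have pw: "u \<in> (\<lambda>k. e [^] k) ` {..<n}" if u: "u \<in> generate G {e}" for u
  proof -
    obtain k :: int where k: "u = e [^] k" using u unfolding generate_pow[OF e] by auto
    define j where "j = nat (k mod int n)"
    have j: "int j = k mod int n" "j < n" using n by (simp_all add: j_def nat_less_iff)
    have "e [^] (int n * (k div int n)) = (e [^] int n) [^] (k div int n)"
      using e by (simp only: int_pow_pow)
    also have "\<dots> = \<one>" using n by (simp only: int_pow_int int_pow_one)
    finally have *: "e [^] (int n * (k div int n)) = \<one>" .
    have "k = int n * (k div int n) + int j" unfolding j(1) by simp
    then have "e [^] k = e [^] (int n * (k div int n)) \<otimes> e [^] int j"
      using int_pow_mult[OF e] by metis
    then have "u = e [^] j" using e * k by (simp add: int_pow_int)
    then show ?thesis using j by blast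
  qed
  have "\<exists>b\<in>B. \<exists>f\<in>(\<lambda>(f, k). f \<otimes> e [^] k) ` (F \<times> {..<n}). x = b \<otimes> f"
    if x: "x \<in> generate G (B \<union> insert e E)" for x
  proof -
    have "B \<union> insert e E \<subseteq> (B \<union> E) \<union> generate G {e}" by (auto intro: generate.incl)
    then have "x \<in> generate G ((B \<union> E) \<union> generate G {e})"
      using x by (rule subsetD[OF mono_generate])
    moreover have "subgroup (generate G {e}) G" using e by (simp add: generate_is_subgroup)
    ultimately have "\<exists>w\<in>generate G (B \<union> E). \<exists>u\<in>generate G {e}. x = w \<otimes> u"
      by (intro generate_Un_subgroup[OF BE])
    then obtain w u where wu: "w \<in> generate G (B \<union> E)" "u \<in> generate G {e}" "x = w \<otimes> u"
      by blast
    obtain b f where bf: "b \<in> B" "f \<in> F" "w = b \<otimes> f" using cov[OF wu(1)] by blast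
    obtain k where k: "k < n" "u = e [^] k" using pw[OF wu(2)] by blast
    have "x = b \<otimes> (f \<otimes> e [^] k)"
      using F e subgroup.mem_carrier[OF B] bf k wu by (simp add: m_assoc subsetD)
    moreover have "f \<otimes> e [^] k \<in> (\<lambda>(f, k). f \<otimes> e [^] k) ` (F \<times> {..<n})"
      using bf k by (intro image_eqI[of _ _ "(f, k)"]) simp_all
    ultimately show ?thesis using bf by blast
  qed
  then show ?case using F e
    by (intro exI[of _ "(\<lambda>(f, k). f \<otimes> e [^] k) ` (F \<times> {..<n})"] conjI ballI) auto
qed

section \<open>Generation by elements of prime order\<close>

text \<open>The identity satisfies the equation for every prime, so it belongs to this set along
  with the elements of prime order.\<close>

definition prime_order_elements :: "('a, 'b) monoid_scheme \<Rightarrow> 'a set"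
  where "prime_order_elements G = {x \<in> carrier G. \<exists>p. prime p \<and> x [^]\<^bsub>G\<^esub> (p::nat) = \<one>\<^bsub>G\<^esub>}"

definition prime_generated :: "('a, 'b) monoid_scheme \<Rightarrow> bool"
  where "prime_generated G \<longleftrightarrow>
    (\<exists>S. finite S \<and> S \<subseteq> prime_order_elements G \<and> generate G S = carrier G)"

lemma prime_order_elements_subset: "prime_order_elements G \<subseteq> carrier G"
  by (auto simp: prime_order_elements_def)

text \<open>A group of prime order is generated by each of its non-trivial elements: the exponent of
  \<open>u\<close> as a power of \<open>s\<close> is prime to \<open>p\<close>, and Bezout recovers
  \<open>s\<close> as a power of \<open>u\<close>.\<close>

lemma (in group) mem_subgroup_if_power_mem:
  assumes s: "s \<in> prime_order_elements G" and T: "subgroup T G"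
    and u: "u \<in> generate G {s}" "u \<noteq> \<one>" "u \<in> T"
  shows "s \<in> T"
proof -
  obtain p :: nat where p: "prime p" "s [^] p = \<one>" and sG: "s \<in> carrier G"
    using s by (auto simp: prime_order_elements_def)
  obtain k :: int where k: "u = s [^] k" using u(1) unfolding generate_pow[OF sG] by auto
  have ordp: "int (ord s) dvd int p" using p sG by (simp add: pow_eq_id)
  have "\<not> int p dvd k"
  proof
    assume "int p dvd k"
    then have "int (ord s) dvd k" using ordp dvd_trans by blast
    then show False using k u(2) sG by (simp add: int_pow_eq_id)
  qed
  then have "coprime k (int p)"
    using p(1) by (metis coprime_commute prime_imp_coprime prime_nat_int_transfer)
  then obtain x y where xy: "x * k + y * int p = 1"
    using bezout_int[of k "int p"] by (metis coprime_imp_gcd_eq_1)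
  have "s = s [^] (x * k + y * int p)" using xy sG by simp
  also have "\<dots> = s [^] (x * k) \<otimes> s [^] (y * int p)" using sG by (rule int_pow_mult)
  also have "s [^] (y * int p) = \<one>" using ordp sG by (simp add: int_pow_eq_id)
  also have "s [^] (x * k) = u [^] x" using k sG by (simp add: int_pow_pow mult.commute)
  finally have "s = u [^] x" using u(3) T subgroup.mem_carrier by fastforce
  then show ?thesis using subgroup_int_pow_closed[OF T u(3), of x] by simp
qed

lemma (in comm_group) finprod_mem_subgroup:
  assumes T: "subgroup T G" and f: "\<And>i. i \<in> I \<Longrightarrow> f i \<in> T"
  shows "finprod G f I \<in> T"
  using f
proof (induction I rule: infinite_finite_induct)
  case (insert i I)
  then have "f \<in> I \<rightarrow> carrier G" "f i \<in> carrier G" using subgroup.mem_carrier[OF T] by auto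
  then show ?case using insert subgroup.m_closed[OF T] by simp
qed (use subgroup.one_closed[OF T] in auto)

text \<open>Strong induction on the exponent \<open>n\<close>, with \<open>sq\<close> excluding
  elements of order \<open>p^2\<close>. If \<open>p^2\<close> divides \<open>n\<close>, the exponent
  drops to \<open>n / p\<close>. Otherwise \<open>n = p r\<close> with \<open>p\<close> and
  \<open>r\<close> coprime, and Bezout expresses \<open>a\<close> through \<open>a^p\<close>, which
  has exponent \<open>r\<close>, and \<open>a^r\<close>, which has exponent
  \<open>p\<close>.\<close>

lemma (in group) mem_generate_prime_order_elements:
  assumes "a \<in> carrier G" "a [^] n = \<one>" "n > (0::nat)"
    and sq: "\<And>x p. x \<in> carrier G \<Longrightarrow> prime (p::nat) \<Longrightarrow> x [^] (p * p) = \<one> \<Longrightarrow> x [^] p = \<one>"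
  shows "a \<in> generate G (prime_order_elements G)"
  using assms(1-3)
proof (induction n arbitrary: a rule: less_induct)
  case (less n)
  let ?P = "generate G (prime_order_elements G)"
  have P: "subgroup ?P G" by (rule generate_is_subgroup[OF prime_order_elements_subset])
  show ?case
  proof (cases "n = 1")
    case True
    then show ?thesis using less.prems generate.one[of G] by simp
  next
    case False
    then obtain p where p: "prime p" "p dvd n" using prime_factor_nat by blast
    then obtain r where r: "n = p * r" by blast
    have "r < n" "r > 0" using r less.prems(3) prime_gt_1_nat[OF p(1)] by simp_all
    show ?thesis
    proof (cases "p dvd r")
      case True
      then obtain r' where r': "r = p * r'" by blast
      have "(a [^] r') [^] (p * p) = \<one>"
        using less.prems r r' by (simp add: nat_pow_pow ac_simps)
      then have "(a [^] r') [^] p = \<one>" using sq p(1) less.prems(1) by blast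
      then have "a [^] r = \<one>" using less.prems(1) r' by (simp add: nat_pow_pow mult.commute)
      then show ?thesis using less.IH[OF \<open>r < n\<close> less.prems(1)] \<open>r > 0\<close> by blast
    next
      case False
      have "coprime (int p) (int r)"
        using p(1) False by (simp add: prime_imp_coprime)
      then obtain x y where xy: "x * int p + y * int r = 1"
        using bezout_int[of "int p" "int r"] by (metis coprime_imp_gcd_eq_1)
      have "(a [^] p) [^] r = \<one>" using less.prems r by (simp add: nat_pow_pow)
      then have 1: "a [^] p \<in> ?P" using less.IH[OF \<open>r < n\<close>] \<open>r > 0\<close> less.prems(1) by blast
      have "(a [^] r) [^] p = \<one>" using less.prems r by (simp add: nat_pow_pow mult.commute)
      then have "a [^] r \<in> prime_order_elements G"
        using p(1) less.prems(1) by (auto simp: prime_order_elements_def)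
      then have 2: "a [^] r \<in> ?P" by (rule generate.incl)
      have "a = a [^] (int p * x + int r * y)" using xy less.prems(1) by (simp add: mult.commute)
      also have "\<dots> = (a [^] p) [^] x \<otimes> (a [^] r) [^] y"
        using less.prems(1) by (simp add: int_pow_mult flip: int_pow_pow int_pow_int)
      also have "\<dots> \<in> ?P"
        using 1 2 by (intro subgroup.m_closed[OF P] subgroup_int_pow_closed[OF P])
      finally show ?thesis .
    qed
  qed
qed

lemma (in group) prime_generatedI:
  assumes fg: "fin_gen_group G"
    and gen: "carrier G \<subseteq> generate G (prime_order_elements G)"
  shows "prime_generated G"
proof -
  let ?P = "prime_order_elements G"
  obtain T where T: "finite T" "T \<subseteq> carrier G" "carrier G = generate G T"
    using fg by (auto simp: fin_gen_group_def fin_gen_subgroup_def)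
  have "\<exists>Q. finite Q \<and> Q \<subseteq> ?P \<and> t \<in> generate G Q" if "t \<in> T" for t
    using generate_finite_support[of t ?P] gen T that by blast
  then obtain Q where Q: "\<And>t. t \<in> T \<Longrightarrow> finite (Q t) \<and> Q t \<subseteq> ?P \<and> t \<in> generate G (Q t)"
    by metis
  let ?S = "\<Union>t\<in>T. Q t"
  have S: "finite ?S" "?S \<subseteq> ?P" using T Q by auto
  have SG: "?S \<subseteq> carrier G" using S(2) prime_order_elements_subset by (rule order_trans)
  have "T \<subseteq> generate G ?S"
  proof
    fix t assume "t \<in> T"
    then show "t \<in> generate G ?S" using Q mono_generate[of "Q t" ?S] by blast
  qed
  then have "generate G T \<subseteq> generate G ?S"
    by (rule generate_subgroup_incl) (rule generate_is_subgroup[OF SG])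
  then have "generate G ?S = carrier G" using T(3) generate_incl[OF SG] by blast
  then show ?thesis unfolding prime_generated_def using S by blast
qed

text \<open>The hypothesis \<open>pw\<close> serves twice: an element whose \<open>p^2\<close>-th
  power is trivial already has trivial \<open>p\<close>-th power, and the instance
  \<open>p = 2\<close> makes the group torsion.\<close>

lemma (in comm_group) prime_generated_if_powers:
  assumes fg: "fin_gen_group G"
    and pw: "\<And>a p. a \<in> carrier G \<Longrightarrow> prime (p::nat) \<Longrightarrow> \<exists>k::int. a [^] p = a [^] (int (p * p) * k)"
  shows "prime_generated G"
proof -
  let ?P = "prime_order_elements G"
  have sq: "x [^] p = \<one>" if x: "x \<in> carrier G" "prime p" "x [^] (p * p) = \<one>" for x and p :: nat
  proof -
    obtain k :: int where "x [^] p = x [^] (int (p * p) * k)" using pw[OF x(1,2)] by blast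
    also have "\<dots> = (x [^] (p * p)) [^] k"
      using x(1) by (simp only: int_pow_pow flip: int_pow_int)
    finally show ?thesis using x(3) by simp
  qed
  have tor: "\<exists>n>0. x [^] (n::nat) = \<one>" if x: "x \<in> carrier G" for x
  proof -
    obtain k :: int where "x [^] (2::nat) = x [^] (int (2 * 2) * k)"
      using pw[OF x two_is_prime_nat] by blast
    then have "x [^] (2::int) = x [^] (4 * k)" by (simp flip: int_pow_int)
    then have "int (ord x) dvd 4 * k - 2" using x by (simp add: int_pow_eq)
    \<comment> \<open>By parity the exponent that annihilates \<open>x\<close> is non-zero, so
      \<open>ord x\<close> is not 0, the value that stands for infinite order.\<close>
    moreover have "4 * k - 2 \<noteq> 0" by presburger
    ultimately have "ord x \<noteq> 0" by (metis dvd_0_left_iff of_nat_0)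
    then show ?thesis using x by (intro exI[of _ "ord x"]) simp
  qed
  have "a \<in> generate G ?P" if a: "a \<in> carrier G" for a
  proof -
    obtain n :: nat where "n > 0" "a [^] n = \<one>" using tor a by blast
    then show ?thesis using mem_generate_prime_order_elements[of a n] sq a by blast
  qed
  then show ?thesis by (intro prime_generatedI[OF fg]) blast
qed

text \<open>A generating set of least cardinality among the finite ones inside
  \<open>prime_order_elements\<close> is independent: none of its members lies in the subgroup
  generated by the others. Multiplying out is then an isomorphism from the direct sum of the cyclic
  groups that its members generate.\<close>

lemma (in comm_group) semisimple_if_prime_generated:
  assumes "prime_generated G"
  shows "semisimple_group G"
proof -
  define good where "good S \<longleftrightarrow>
    finite S \<and> S \<subseteq> prime_order_elements G \<and> generate G S = carrier G" for S
  obtain S where S: "good S" and min: "\<And>S'. good S' \<Longrightarrow> card S \<le> card S'"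
    using assms ex_has_least_nat[of good _ card] unfolding prime_generated_def good_def by metis
  have fin: "finite S" and SP: "S \<subseteq> prime_order_elements G" and gen: "generate G S = carrier G"
    using S by (simp_all add: good_def)
  have SG: "S \<subseteq> carrier G" using SP prime_order_elements_subset by (rule order_trans)
  have sub: "subgroup (generate G (S - {s})) G" for s
    using SG by (intro generate_is_subgroup) blast
  have indep: "s \<notin> generate G (S - {s})" if s: "s \<in> S" for s
  proof
    assume "s \<in> generate G (S - {s})"
    then have "S \<subseteq> generate G (S - {s})" by (auto intro: generate.incl)
    then have "carrier G \<subseteq> generate G (S - {s})"
      using generate_subgroup_incl[OF _ sub] gen by blast
    then have "generate G (S - {s}) = carrier G"
      using subgroup.subset[OF sub] by blast
    then have "good (S - {s})" using fin SP by (auto simp: good_def)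
    then have "card S \<le> card (S - {s})" by (rule min)
    then show False using card_Diff1_less[OF fin s] by simp
  qed
  \<comment> \<open>The record is written out because the summands must be plain monoids, whereas
    \<open>G\<close> may carry further fields.\<close>
  define C :: "'a \<Rightarrow> 'a monoid"
    where "C s = \<lparr>carrier = generate G {s}, monoid.mult = (\<otimes>), one = \<one>\<rparr>" for s
  have gs: "subgroup (generate G {s}) G" if "s \<in> S" for s
    using SG that by (intro generate_is_subgroup) blast
  have C: "group (C s) \<and> cyclic_group (C s) \<and> prime (order (C s))" if s: "s \<in> S" for s
  proof -
    interpret gs: subgroup "generate G {s}" G using gs s by blast
    have sG: "s \<in> carrier G" using s SG by blast
    have grp: "group (C s)"
      by (rule groupI) (auto simp: C_def m_assoc intro: gs.m_inv_closed l_inv[OF gs.mem_carrier])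
    have "id \<in> iso (subgroup_generated G {s}) (C s)"
      using sG by (auto simp: iso_def hom_def C_def carrier_subgroup_generated)
    then have "subgroup_generated G {s} \<cong> C s" by (rule is_isoI)
    then have cyc: "cyclic_group (C s)"
      using isomorphic_group_cyclicity[of "subgroup_generated G {s}" "C s"] grp
        cyclic_group_generated by simp
    obtain p :: nat where p: "prime p" "s [^] p = \<one>"
      using s SP by (auto simp: prime_order_elements_def)
    have "s \<noteq> \<one>" using indep[OF s] generate.one[of G] by auto
    then have "ord s \<noteq> 1" using ord_eq_1[OF sG] by metis
    moreover have "ord s dvd p" using p sG by (simp add: pow_eq_id)
    ultimately have "ord s = p" using p(1) by (metis prime_nat_iff)
    then have "order (C s) = p"
      using generate_pow_card[OF sG] by (simp add: order_def C_def)
    then show ?thesis using grp cyc p(1) by simp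
  qed
  let ?S = "sum_group S C" and ?\<phi> = "\<lambda>f. finprod G f S"
  have carS: "carrier ?S = {f \<in> \<Pi>\<^sub>E s\<in>S. generate G {s}. finite {s \<in> S. f s \<noteq> \<one>}}"
    using carrier_sum_group[of S C] C by (simp add: C_def)
  have val: "f s \<in> generate G {s}" if "f \<in> carrier ?S" "s \<in> S" for f s
    using that unfolding carS by auto
  have valG: "f \<in> S \<rightarrow> carrier G" if "f \<in> carrier ?S" for f
    using val[OF that] subgroup.mem_carrier[OF gs] by auto
  have grpS: "group ?S" using C by simp
  have hom: "?\<phi> \<in> hom ?S G"
  proof (rule homI)
    show "?\<phi> f \<in> carrier G" if "f \<in> carrier ?S" for f
      using valG[OF that] by (rule finprod_closed)
    show "?\<phi> (f \<otimes>\<^bsub>?S\<^esub> g) = ?\<phi> f \<otimes> ?\<phi> g" if "f \<in> carrier ?S" "g \<in> carrier ?S" for f g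
    proof -
      have "?\<phi> (f \<otimes>\<^bsub>?S\<^esub> g) = finprod G (\<lambda>s. f s \<otimes> g s) S"
        using valG[OF that(1)] valG[OF that(2)] by (intro finprod_cong') (auto simp: C_def)
      then show ?thesis using valG[OF that(1)] valG[OF that(2)] by simp
    qed
  qed
  then interpret \<phi>: group_hom ?S G ?\<phi>
    using grpS by (simp add: group_hom_def group_hom_axioms_def is_group)
  have "S \<subseteq> ?\<phi> ` carrier ?S"
  proof
    fix s assume s: "s \<in> S"
    let ?f = "\<lambda>t\<in>S. if t = s then s else \<one>"
    have "{t \<in> S. ?f t \<noteq> \<one>} \<subseteq> {s}" by auto
    then have "finite {t \<in> S. ?f t \<noteq> \<one>}" by (rule finite_subset) simp
    then have "?f \<in> carrier ?S" unfolding carS by (auto intro: generate.incl generate.one)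
    moreover have "?\<phi> ?f = (\<Otimes>t\<in>S. if t = s then s else \<one>)"
      using s SG by (intro finprod_cong') auto
    moreover have "\<dots> = s" using finprod_singleton_swap[OF s fin, of "\<lambda>_. s"] s SG by auto
    ultimately show "s \<in> ?\<phi> ` carrier ?S" by (metis image_eqI)
  qed
  then have "generate G S \<subseteq> ?\<phi> ` carrier ?S"
    by (rule generate_subgroup_incl) (rule \<phi>.img_is_subgroup)
  then have surj: "?\<phi> ` carrier ?S = carrier G"
    using gen \<phi>.img_is_subgroup subgroup.subset by blast
  have "f = \<one>\<^bsub>?S\<^esub>" if f: "f \<in> carrier ?S" "?\<phi> f = \<one>" for f
  proof -
    \<comment> \<open>A non-trivial factor \<open>f s\<close> would be the inverse of the product of
      the other factors, hence lie in the subgroup generated by \<open>S - {s}\<close>. As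
      \<open>f s\<close> is a non-trivial power of \<open>s\<close>, also \<open>s\<close> would lie
      there, against independence.\<close>
    have "f s = \<one>" if s: "s \<in> S" for s
    proof (rule ccontr)
      assume "f s \<noteq> \<one>"
      let ?g = "finprod G f (S - {s})"
      have g: "?g \<in> generate G (S - {s})"
      proof (rule finprod_mem_subgroup[OF sub])
        fix t assume t: "t \<in> S - {s}"
        then have "f t \<in> generate G {t}" using val f(1) by blast
        then show "f t \<in> generate G (S - {s})" using mono_generate[of "{t}" "S - {s}"] t by blast
      qed
      have "?\<phi> f = finprod G f (insert s (S - {s}))" using s by (simp add: insert_absorb)
      also have "\<dots> = f s \<otimes> ?g"
        using fin valG[OF f(1)] s by (intro finprod_insert) auto
      finally have "f s \<otimes> ?g = \<one>" using f(2) by simp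
      then have "f s = inv ?g"
        using valG[OF f(1)] s subgroup.mem_carrier[OF sub g] by (metis Pi_mem inv_equality)
      then have "f s \<in> generate G (S - {s})" using subgroup.m_inv_closed[OF sub g] by simp
      then have "s \<in> generate G (S - {s})"
        using mem_subgroup_if_power_mem[OF _ sub val[OF f(1) s] \<open>f s \<noteq> \<one>\<close>] SP s by blast
      then show False using indep s by blast
    qed
    then show ?thesis using f(1) unfolding carS
      by (auto simp: fun_eq_iff PiE_iff extensional_def C_def)
  qed
  then have "inj_on ?\<phi> (carrier ?S)" by (simp only: \<phi>.inj_on_one_iff) blast
  then have "?\<phi> \<in> iso ?S G" using hom surj by (simp add: iso_def bij_betw_def)
  then have "?S \<cong> G" by (rule is_isoI)
  then have "G \<cong> ?S" using grpS group.iso_sym by blast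
  then show ?thesis using C by (intro semisimple_groupI[of G S C]) (simp_all add: comm_group_axioms)
qed

text \<open>A finitely supported function is the product of its restrictions to single coordinates.
  The induction runs over a finite set \<open>T\<close> containing the support and splits off one
  coordinate at a time.\<close>

lemma sum_group_mem_subgroup:
  assumes C: "\<And>i. i \<in> I \<Longrightarrow> group (C i)" and X: "subgroup X (sum_group I C)"
    and f: "f \<in> carrier (sum_group I C)"
    and single: "\<And>i. i \<in> I \<Longrightarrow> (\<lambda>j\<in>I. if j = i then f i else \<one>\<^bsub>C j\<^esub>) \<in> X"
  shows "f \<in> X"
proof -
  have car: "carrier (sum_group I C) = {x \<in> \<Pi>\<^sub>E i\<in>I. carrier (C i). finite {i \<in> I. x i \<noteq> \<one>\<^bsub>C i\<^esub>}}"
    using C by (rule carrier_sum_group)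
  have one: "\<one>\<^bsub>C i\<^esub> \<in> carrier (C i)" if "i \<in> I" for i
    using C[OF that] by (simp add: group.is_monoid monoid.one_closed)
  have "finite T \<Longrightarrow> g \<in> carrier (sum_group I C) \<Longrightarrow> {i \<in> I. g i \<noteq> \<one>\<^bsub>C i\<^esub>} \<subseteq> T \<Longrightarrow>
    (\<And>i. i \<in> I \<Longrightarrow> (\<lambda>j\<in>I. if j = i then g i else \<one>\<^bsub>C j\<^esub>) \<in> X) \<Longrightarrow> g \<in> X" for T g
  proof (induction T arbitrary: g rule: finite_induct)
    case empty
    then have "g = \<one>\<^bsub>sum_group I C\<^esub>"
      unfolding car by (auto simp: fun_eq_iff PiE_iff extensional_def)
    then show ?case using subgroup.one_closed[OF X] by (simp only:)
  next
    case (insert t T)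
    show ?case
    proof (cases "t \<in> I")
      case True
      let ?d = "\<lambda>j\<in>I. if j = t then g t else \<one>\<^bsub>C j\<^esub>"
      let ?h = "\<lambda>j\<in>I. if j = t then \<one>\<^bsub>C t\<^esub> else g j"
      have "{i \<in> I. ?h i \<noteq> \<one>\<^bsub>C i\<^esub>} \<subseteq> {i \<in> I. g i \<noteq> \<one>\<^bsub>C i\<^esub>}" by auto
      then have "finite {i \<in> I. ?h i \<noteq> \<one>\<^bsub>C i\<^esub>}"
        by (rule finite_subset) (use insert.prems(1) car in auto)
      then have h: "?h \<in> carrier (sum_group I C)"
        using insert.prems(1) one unfolding car by (auto simp: PiE_iff)
      have "?h \<in> X"
      proof (rule insert.IH[OF h])
        show "{i \<in> I. ?h i \<noteq> \<one>\<^bsub>C i\<^esub>} \<subseteq> T" using insert.prems(2) by auto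
        fix i assume i: "i \<in> I"
        show "(\<lambda>j\<in>I. if j = i then ?h i else \<one>\<^bsub>C j\<^esub>) \<in> X"
        proof (cases "i = t")
          case True
          have "(\<lambda>j\<in>I. if j = i then ?h i else \<one>\<^bsub>C j\<^esub>) = \<one>\<^bsub>sum_group I C\<^esub>"
            using True i by (auto simp: fun_eq_iff)
          then show ?thesis using subgroup.one_closed[OF X] by (simp only:)
        next
          case False
          then show ?thesis using insert.prems(3)[OF i] i by (simp only: restrict_apply' if_False)
        qed
      qed
      then have "?d \<otimes>\<^bsub>sum_group I C\<^esub> ?h \<in> X"
        using insert.prems(3)[OF True] by (intro subgroup.m_closed[OF X])
      moreover have "?d \<otimes>\<^bsub>sum_group I C\<^esub> ?h = g"
        using insert.prems(1) C unfolding car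
        by (auto simp: fun_eq_iff PiE_iff extensional_def group.is_monoid monoid.l_one monoid.r_one)
      ultimately show ?thesis by simp
    next
      case False
      then have "{i \<in> I. g i \<noteq> \<one>\<^bsub>C i\<^esub>} \<subseteq> T" using insert.prems(2) by auto
      then show ?thesis using insert.IH insert.prems by blast
    qed
  qed
  from this[of "{i \<in> I. f i \<noteq> \<one>\<^bsub>C i\<^esub>}" f] show ?thesis using f single car by blast
qed

text \<open>An element living in a single summand \<open>C i\<close> is killed by the prime
  \<open>order (C i)\<close>, so its image lies in \<open>prime_order_elements G\<close>. Such
  elements generate the sum, and finite generation leaves finitely many of them.\<close>

lemma (in comm_group) prime_generated_if_semisimple:
  assumes fg: "fin_gen_group G" and ss: "semisimple_group G"
  shows "prime_generated G"
proof -
  let ?P = "prime_order_elements G"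
  obtain I :: "'a set" and C :: "'a \<Rightarrow> 'a monoid"
    where C: "\<And>i. i \<in> I \<Longrightarrow> group (C i) \<and> cyclic_group (C i) \<and> prime (order (C i))"
      and iso: "G \<cong> sum_group I C"
    using ss unfolding semisimple_group_def by blast
  let ?S = "sum_group I C"
  have grpC: "\<And>i. i \<in> I \<Longrightarrow> group (C i)" using C by blast
  have grpS: "group ?S" using grpC by simp
  have car: "carrier ?S = {x \<in> \<Pi>\<^sub>E i\<in>I. carrier (C i). finite {i \<in> I. x i \<noteq> \<one>\<^bsub>C i\<^esub>}}"
    using grpC by (rule carrier_sum_group)
  have "?S \<cong> G" using iso by (rule iso_sym)
  then obtain \<phi> where \<phi>: "\<phi> \<in> iso ?S G" by (auto simp: is_iso_def)
  then have hom: "\<phi> \<in> hom ?S G" and img: "\<phi> ` carrier ?S = carrier G"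
    by (auto simp: iso_def bij_betw_def)
  interpret \<phi>: group_hom ?S G \<phi>
    using hom grpS by (simp add: group_hom_def group_hom_axioms_def is_group)
  have P: "subgroup (generate G ?P) G" by (rule generate_is_subgroup[OF prime_order_elements_subset])
  define X where "X = {f \<in> carrier ?S. \<phi> f \<in> generate G ?P}"
  have X: "subgroup X ?S"
    by (rule group.subgroupI[OF grpS])
      (auto simp: X_def simp del: mult_sum_group inv_sum_group one_sum_group
        intro: subgroup.m_closed[OF P] subgroup.m_inv_closed[OF P] generate.one
        intro!: exI[of _ "\<one>\<^bsub>?S\<^esub>"])
  have "f \<in> X" if f: "f \<in> carrier ?S" for f
  proof (rule sum_group_mem_subgroup[OF grpC X f])
    fix i assume i: "i \<in> I"
    interpret Ci: group "C i" using grpC i .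
    let ?e = "\<lambda>c. \<lambda>j\<in>I. if j = i then c else \<one>\<^bsub>C j\<^esub>"
    have e: "?e c \<in> carrier ?S" if "c \<in> carrier (C i)" for c
    proof -
      have "{j \<in> I. ?e c j \<noteq> \<one>\<^bsub>C j\<^esub>} \<subseteq> {i}" by auto
      then have "finite {j \<in> I. ?e c j \<noteq> \<one>\<^bsub>C j\<^esub>}" by (rule finite_subset) simp
      then show ?thesis using that grpC unfolding car
        by (auto simp: group.is_monoid monoid.one_closed)
    qed
    have "?e \<in> hom (C i) ?S"
      using e grpC by (intro homI) (auto simp: fun_eq_iff group.is_monoid monoid.l_one)
    then have pow: "?e (c [^]\<^bsub>C i\<^esub> n) = ?e c [^]\<^bsub>?S\<^esub> n" if "c \<in> carrier (C i)" for c and n :: nat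
      using hom_nat_pow[OF _ that Ci.is_group grpS, of ?e n] by simp
    have fi: "f i \<in> carrier (C i)" using f i unfolding car by auto
    have "f i [^]\<^bsub>C i\<^esub> order (C i) = \<one>\<^bsub>C i\<^esub>" using fi by (rule Ci.pow_order_eq_1)
    then have "?e (f i) [^]\<^bsub>?S\<^esub> order (C i) = ?e \<one>\<^bsub>C i\<^esub>"
      using pow[OF fi, of "order (C i)"] by (simp only:)
    also have "\<dots> = \<one>\<^bsub>?S\<^esub>" by (auto simp: fun_eq_iff)
    finally have "?e (f i) [^]\<^bsub>?S\<^esub> order (C i) = \<one>\<^bsub>?S\<^esub>" .
    then have "\<phi> (?e (f i)) [^] order (C i) = \<one>"
      using \<phi>.hom_nat_pow[OF e[OF fi], of "order (C i)"] \<phi>.hom_one by metis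
    then have "\<phi> (?e (f i)) \<in> ?P"
      using C[OF i] e[OF fi] by (auto simp: prime_order_elements_def)
    then show "?e (f i) \<in> X" using e[OF fi] by (simp add: X_def generate.incl)
  qed
  then have "\<phi> ` carrier ?S \<subseteq> generate G ?P" by (intro image_subsetI) (simp add: X_def)
  then have "carrier G \<subseteq> generate G ?P" by (simp only: img)
  then show ?thesis by (rule prime_generatedI[OF fg])
qed

section \<open>The wreath product with the integers\<close>

lemma restrict_UNIV_eq: "restrict f UNIV = f"
  by (simp add: restrict_def)

locale wreath_int = comm_group A for A (structure)
begin

abbreviation N :: "(int \<Rightarrow> 'a) monoid"
  where "N \<equiv> sum_group (UNIV :: int set) (\<lambda>_. A)"

abbreviation W :: "((int \<Rightarrow> 'a) \<times> int) monoid"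
  where "W \<equiv> restricted_wreath A integer_group"

text \<open>The action of the integer \<open>k\<close> by conjugation; it carries the value at
  \<open>x\<close> to position \<open>x - k\<close>.\<close>

definition shift :: "int \<Rightarrow> (int \<Rightarrow> 'a) \<Rightarrow> int \<Rightarrow> 'a"
  where "shift k f = (\<lambda>x. f (x + k))"

definition delta :: "int \<Rightarrow> 'a \<Rightarrow> int \<Rightarrow> 'a"
  where "delta x a = (\<lambda>y. if y = x then a else \<one>)"

lemma mem_N_iff: "f \<in> carrier N \<longleftrightarrow> (\<forall>x. f x \<in> carrier A) \<and> finite {x. f x \<noteq> \<one>}"
  using carrier_sum_group[of "UNIV :: int set" "\<lambda>_. A"] by (auto simp: is_group PiE_iff)

lemma N_closed [simp]: "f \<in> carrier N \<Longrightarrow> f x \<in> carrier A"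
  by (simp add: mem_N_iff)

lemma mult_N: "f \<otimes>\<^bsub>N\<^esub> g = (\<lambda>x. f x \<otimes> g x)"
  by (simp add: restrict_UNIV_eq)

lemma one_N: "\<one>\<^bsub>N\<^esub> = (\<lambda>x. \<one>)"
  by (simp add: restrict_UNIV_eq)

lemma inv_N: "f \<in> carrier N \<Longrightarrow> inv\<^bsub>N\<^esub> f = (\<lambda>x. inv (f x))"
  by (simp add: inv_sum_group is_group restrict_UNIV_eq)

sublocale N: comm_group N
proof (rule group.group_comm_groupI)
  show "group N" by (simp add: is_group)
  show "f \<otimes>\<^bsub>N\<^esub> g = g \<otimes>\<^bsub>N\<^esub> f" if "f \<in> carrier N" "g \<in> carrier N" for f g
    using that by (auto simp: m_comm)
qed

lemma pow_N: "f \<in> carrier N \<Longrightarrow> f [^]\<^bsub>N\<^esub> (n::nat) = (\<lambda>x. f x [^] n)"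
  by (induction n) auto

lemma carrier_W: "carrier W = carrier N \<times> UNIV"
  by (simp add: restricted_wreath_def semidirect_product_def)

lemma mult_W: "(f, k) \<otimes>\<^bsub>W\<^esub> (g, l) = (f \<otimes>\<^bsub>N\<^esub> shift k g, k + l)"
  by (simp add: restricted_wreath_def semidirect_product_def shift_def)

lemma one_W: "\<one>\<^bsub>W\<^esub> = (\<one>\<^bsub>N\<^esub>, 0)"
  by (simp add: restricted_wreath_def semidirect_product_def)

sublocale W: group W
  by (simp add: group_restricted_wreath is_group)

lemma shift_closed [simp]:
  assumes "f \<in> carrier N"
  shows "shift k f \<in> carrier N"
  using action_sum_group[OF is_group group_integer_group, of k f] assms by (simp add: shift_def restrict_UNIV_eq)

lemma shift_shift [simp]: "shift k (shift l f) = shift (k + l) f"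
  by (simp add: shift_def ac_simps)

lemma shift_0 [simp]: "shift 0 f = f"
  by (simp add: shift_def)

lemma shift_mult: "shift k (f \<otimes>\<^bsub>N\<^esub> g) = shift k f \<otimes>\<^bsub>N\<^esub> shift k g"
  by (simp add: shift_def restrict_UNIV_eq)

lemma shift_one [simp]: "shift k \<one>\<^bsub>N\<^esub> = \<one>\<^bsub>N\<^esub>"
  by (simp add: shift_def restrict_UNIV_eq)

lemma shift_inv: "f \<in> carrier N \<Longrightarrow> shift k (inv\<^bsub>N\<^esub> f) = inv\<^bsub>N\<^esub> (shift k f)"
  by (simp add: inv_N del: inv_sum_group) (simp add: shift_def)

lemma inv_W: "f \<in> carrier N \<Longrightarrow> inv\<^bsub>W\<^esub> (f, k) = (shift (- k) (inv\<^bsub>N\<^esub> f), - k)"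
  by (rule W.inv_equality)
    (simp_all add: mult_W one_W carrier_W del: mult_sum_group one_sum_group inv_sum_group
      flip: shift_mult)

declare mult_sum_group [simp del] one_sum_group [simp del] inv_sum_group [simp del]

lemma delta_closed [simp]:
  assumes "a \<in> carrier A"
  shows "delta x a \<in> carrier N"
proof -
  have "{y. delta x a y \<noteq> \<one>} \<subseteq> {x}" by (auto simp: delta_def)
  then have "finite {y. delta x a y \<noteq> \<one>}" by (rule finite_subset) simp
  then show ?thesis using assms by (auto simp: mem_N_iff delta_def)
qed

lemma delta_one [simp]: "delta x \<one> = \<one>\<^bsub>N\<^esub>"
  by (auto simp: delta_def one_N)

lemma shift_delta: "shift k (delta x a) = delta (x - k) a"
  by (auto simp: delta_def shift_def)

lemma delta_hom: "delta x \<in> hom A N"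
  by (rule homI) (simp, auto simp: mult_N fun_eq_iff delta_def)

lemma subgroup_delta_vimage:
  assumes "subgroup X N"
  shows "subgroup {a \<in> carrier A. delta x a \<in> X} A"
proof -
  interpret d: group_hom A N "delta x"
    using delta_hom by (simp add: group_hom_def group_hom_axioms_def is_group N.is_group)
  show ?thesis
    by (rule subgroupI)
      (use assms in \<open>auto simp: subgroup.m_closed subgroup.m_inv_closed subgroup.one_closed
        intro!: exI[of _ \<one>]\<close>)
qed

lemma delta_generate_mem:
  assumes "subgroup X N" "C \<subseteq> carrier A" "\<And>c. c \<in> C \<Longrightarrow> delta x c \<in> X" "a \<in> generate A C"
  shows "delta x a \<in> X"
proof -
  have "generate A C \<subseteq> {a \<in> carrier A. delta x a \<in> X}"
    using assms subgroup_delta_vimage by (intro generate_subgroup_incl) auto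
  then show ?thesis using assms(4) by blast
qed

lemma mem_subgroup_N:
  assumes "subgroup X N" "f \<in> carrier N" "\<And>x. delta x (f x) \<in> X"
  shows "f \<in> X"
  by (rule sum_group_mem_subgroup[of UNIV "\<lambda>_. A"])
    (use assms in \<open>auto simp: is_group delta_def restrict_UNIV_eq\<close>)

text \<open>For \<open>m > 0\<close> and \<open>s\<close> of prime order \<open>p\<close>, this is
  the free module of rank one on \<open>delta i s\<close> over the Laurent polynomials with
  coefficients modulo \<open>p\<close>, the variable acting as the shift by
  \<open>m\<close>.\<close>

definition residue_subgroup :: "int \<Rightarrow> int \<Rightarrow> 'a \<Rightarrow> (int \<Rightarrow> 'a) set"
  where "residue_subgroup m i s =
    {f \<in> carrier N. \<forall>x. f x \<in> generate A {s} \<and> (f x \<noteq> \<one> \<longrightarrow> x mod m = i mod m)}"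

lemma subgroup_residue_subgroup:
  assumes "s \<in> carrier A"
  shows "subgroup (residue_subgroup m i s) N"
proof -
  interpret s: subgroup "generate A {s}" A using assms by (simp add: generate_is_subgroup)
  show ?thesis
  proof (rule N.subgroupI)
    show "residue_subgroup m i s \<noteq> {}"
      unfolding residue_subgroup_def using N.one_closed by (force simp: one_N)
    show "inv\<^bsub>N\<^esub> f \<in> residue_subgroup m i s" if "f \<in> residue_subgroup m i s" for f
      using that N.inv_closed[of f] unfolding residue_subgroup_def by (auto simp: inv_N)
    show "f \<otimes>\<^bsub>N\<^esub> g \<in> residue_subgroup m i s"
      if "f \<in> residue_subgroup m i s" "g \<in> residue_subgroup m i s" for f g
      using that N.m_closed[of f g] unfolding residue_subgroup_def
      by (auto simp: mult_N) (metis l_one r_one s.one_closed s.mem_carrier)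
  qed (auto simp: residue_subgroup_def)
qed

lemma shift_residue_subgroup:
  assumes "f \<in> residue_subgroup m i s" "m dvd k"
  shows "shift k f \<in> residue_subgroup m i s"
proof -
  have "(x + k) mod m = x mod m" for x using assms(2) by (metis mod_add_right_eq dvd_imp_mod_0 add_0_right)
  then show ?thesis using assms(1) shift_closed[of f k]
    unfolding residue_subgroup_def by (auto simp: shift_def)
qed

end

text \<open>\<open>T\<close> plays the support of a Laurent polynomial, and \<open>step\<close>
  passes \<open>P\<close> from all but one point of a translate of \<open>T\<close> to the remaining
  point. So the half-open window from \<open>Min T\<close> to \<open>Max T\<close> extends to the
  right by solving for the largest point, and then to the left by solving for the smallest.\<close>

lemma all_int_if_support_propagates:
  fixes T :: "int set"
  assumes T: "finite T" "T \<noteq> {}"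
    and step: "\<And>k t. t \<in> T \<Longrightarrow> (\<And>t'. t' \<in> T - {t} \<Longrightarrow> P (t' + k)) \<Longrightarrow> P (t + k)"
    and base: "\<And>x. Min T \<le> x \<Longrightarrow> x < Max T \<Longrightarrow> P x"
  shows "P x"
proof -
  have up: "P x" if "Min T \<le> x" "x < Max T + int n" for x n
    using that
  proof (induction n arbitrary: x)
    case 0
    then show ?case using base by simp
  next
    case (Suc n)
    show ?case
    proof (cases "x = Max T + int n")
      case True
      have "P (t' + int n)" if "t' \<in> T - {Max T}" for t'
      proof (rule Suc.IH)
        have "Min T \<le> t'" using T that by simp
        then show "Min T \<le> t' + int n" by simp
        have "t' \<le> Max T" "t' \<noteq> Max T" using T that by auto
        then show "t' + int n < Max T + int n" by simp
      qed
      then show ?thesis using step[of "Max T" "int n"] T True by simp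
    qed (use Suc in auto)
  qed
  have right: "P x" if "Min T \<le> x" for x
    using up[of x "nat (x - Max T + 1)"] that by linarith
  have "P x" if "Min T - int n \<le> x" for x n
    using that
  proof (induction n arbitrary: x)
    case 0
    then show ?case using right by simp
  next
    case (Suc n)
    show ?case
    proof (cases "x = Min T - int (Suc n)")
      case True
      have "P (t' + (- int (Suc n)))" if "t' \<in> T - {Min T}" for t'
      proof (rule Suc.IH)
        have "Min T \<le> t'" "t' \<noteq> Min T" using T that by auto
        then show "Min T - int n \<le> t' + (- int (Suc n))" by simp
      qed
      then have "P (Min T + (- int (Suc n)))" using step[of "Min T" "- int (Suc n)"] T by simp
      moreover have "Min T + (- int (Suc n)) = x" using True by simp
      ultimately show ?thesis by (simp only:)
    qed (use Suc in auto)
  qed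
  from this[of "nat (Min T - x)" x] show ?thesis by linarith
qed

section \<open>Shift-invariant subgroups of finite index in the base group\<close>

context wreath_int
begin

text \<open>Translating \<open>u\<close> so that a single point of its support lies outside the positions
  already reached isolates that point.\<close>

lemma delta_mem_if_window:
  assumes s: "s \<in> prime_order_elements A"
    and B: "\<And>f k. f \<in> B \<Longrightarrow> m dvd k \<Longrightarrow> shift k f \<in> B"
    and u: "u \<in> B" "u \<in> residue_subgroup m i s" "u \<noteq> \<one>\<^bsub>N\<^esub>"
    and X: "subgroup X N" "B \<subseteq> X"
    and win: "\<And>y. Min {x. u x \<noteq> \<one>} \<le> y \<Longrightarrow> y < Max {x. u x \<noteq> \<one>} \<Longrightarrow> delta y s \<in> X"
    and y: "y mod m = i mod m"
  shows "delta y s \<in> X"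
proof -
  let ?T = "{x. u x \<noteq> \<one>}"
  have sA: "s \<in> carrier A" using s prime_order_elements_subset[of A] by blast
  have uN: "u \<in> carrier N" and us: "\<And>x. u x \<in> generate A {s}"
    and um: "\<And>x. u x \<noteq> \<one> \<Longrightarrow> x mod m = i mod m"
    using u(2) by (auto simp: residue_subgroup_def)
  \<comment> \<open>Guarding the claim by the residue class makes it vacuous at all other positions,
    so it can be propagated over all integers.\<close>
  have "y mod m = i mod m \<longrightarrow> delta y s \<in> X"
  proof (rule all_int_if_support_propagates[of ?T "\<lambda>y. y mod m = i mod m \<longrightarrow> delta y s \<in> X"])
    show "finite ?T" using uN by (simp add: mem_N_iff)
    show "?T \<noteq> {}" using u(3) by (auto simp: one_N)
    show "x mod m = i mod m \<longrightarrow> delta x s \<in> X" if "Min ?T \<le> x" "x < Max ?T" for x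
      using win that by blast
    fix k t
    assume t: "t \<in> ?T"
      and IH: "\<And>t'. t' \<in> ?T - {t} \<Longrightarrow> (t' + k) mod m = i mod m \<longrightarrow> delta (t' + k) s \<in> X"
    show "(t + k) mod m = i mod m \<longrightarrow> delta (t + k) s \<in> X"
    proof
      assume "(t + k) mod m = i mod m"
      \<comment> \<open>A point \<open>t\<close> of the support lies in the class of
        \<open>i\<close> already, so \<open>k\<close> is a multiple of \<open>m\<close> and
        translation by it preserves \<open>B\<close>.\<close>
      then have "m dvd (t + k) - t" using um t by (simp only: mod_eq_dvd_iff[symmetric]) simp
      then have k: "m dvd k" by simp
      define v where "v = shift (- k) u"
      have v: "v \<in> X" using B[OF u(1), of "- k"] k X(2) by (auto simp: v_def)
      have vN: "v \<in> carrier N" using uN by (simp add: v_def)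
      \<comment> \<open>\<open>g\<close> is the translate \<open>v\<close> with its value at
        \<open>t + k\<close> erased. Its remaining values are covered by \<open>IH\<close>, so
        \<open>g\<close> lies in \<open>X\<close>, and dividing it out of \<open>v\<close> leaves
        the single value \<open>u t\<close> at \<open>t + k\<close>.\<close>
      define g where "g = (\<lambda>x. if x = t + k then \<one> else v x)"
      have "{x. g x \<noteq> \<one>} \<subseteq> {x. v x \<noteq> \<one>}" by (auto simp: g_def)
      then have "finite {x. g x \<noteq> \<one>}"
        by (rule finite_subset) (use vN in \<open>simp add: mem_N_iff\<close>)
      then have gN: "g \<in> carrier N"
        using vN unfolding mem_N_iff[of g] by (simp add: g_def)
      have "g \<in> X"
      proof (rule mem_subgroup_N[OF X(1) gN])
        fix x
        show "delta x (g x) \<in> X"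
        proof (cases "g x = \<one>")
          case True
          then show ?thesis using subgroup.one_closed[OF X(1)] by simp
        next
          case False
          then have "x - k \<in> ?T - {t}" "g x = u (x - k)"
            by (auto simp: g_def v_def shift_def split: if_splits)
          moreover from this have "(x - k + k) mod m = i mod m"
            using um[of "x - k"] k by (metis (mono_tags, lifting) Diff_iff dvd_imp_mod_0 mem_Collect_eq mod_add_right_eq add_0_right)
          ultimately have "delta x s \<in> X" using IH[of "x - k"] by simp
          then show ?thesis using delta_generate_mem[OF X(1), of "{s}" x] us sA \<open>g x = u (x - k)\<close>
            by simp
        qed
      qed
      then have "v \<otimes>\<^bsub>N\<^esub> inv\<^bsub>N\<^esub> g \<in> X"
        using v subgroup.m_closed[OF X(1)] subgroup.m_inv_closed[OF X(1)] by blast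
      moreover have "v \<otimes>\<^bsub>N\<^esub> inv\<^bsub>N\<^esub> g = delta (t + k) (u t)"
        using vN gN by (auto simp: fun_eq_iff mult_N inv_N delta_def g_def)
          (simp add: v_def shift_def)
      ultimately have "u t \<in> {a \<in> carrier A. delta (t + k) a \<in> X}" using uN by simp
      \<comment> \<open>So far only a power of \<open>s\<close> has been reached; as it is
        non-trivial, primality recovers \<open>s\<close> itself.\<close>
      then have "s \<in> {a \<in> carrier A. delta (t + k) a \<in> X}"
        using mem_subgroup_if_power_mem[OF s subgroup_delta_vimage[OF X(1)] us] t by blast
      then show "delta (t + k) s \<in> X" by simp
    qed
  qed
  then show ?thesis using y by blast
qed

text \<open>By \<open>hit\<close>, \<open>B\<close> contains each of the finitely many residue
  modules or at least a non-zero element of it. Modulo such an element the module is spanned by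
  finitely many \<open>delta y s\<close>. Adjoining all of these to \<open>B\<close> gives
  \<open>N\<close>, and since they are torsion, \<open>B\<close> has finite index.\<close>

lemma finite_transversal:
  assumes m: "m > 0"
    and S: "finite S" "S \<subseteq> prime_order_elements A" "generate A S = carrier A"
    and B: "subgroup B N" "\<And>f k. f \<in> B \<Longrightarrow> m dvd k \<Longrightarrow> shift k f \<in> B"
    and hit: "\<And>i s. s \<in> S \<Longrightarrow> 0 \<le> i \<Longrightarrow> i < m \<Longrightarrow>
      residue_subgroup m i s \<subseteq> B \<or> (\<exists>u\<in>B. u \<in> residue_subgroup m i s \<and> u \<noteq> \<one>\<^bsub>N\<^esub>)"
  shows "\<exists>F. finite F \<and> F \<subseteq> carrier N \<and> (\<forall>f\<in>carrier N. \<exists>b\<in>B. \<exists>\<phi>\<in>F. f = b \<otimes>\<^bsub>N\<^esub> \<phi>)"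
proof -
  have SA: "S \<subseteq> carrier A" using S(2) prime_order_elements_subset by (rule order_trans)
  \<comment> \<open>\<open>Y\<close> has to work for every \<open>X\<close>, because the
    \<open>X\<close> used later is generated by \<open>B\<close> together with the contributions of
    all these sets \<open>Y\<close>.\<close>
  have "\<exists>Y::int set. finite Y \<and> (\<forall>X. subgroup X N \<longrightarrow> B \<subseteq> X \<longrightarrow> (\<forall>y\<in>Y. delta y s \<in> X) \<longrightarrow>
      (\<forall>y. y mod m = i \<longrightarrow> delta y s \<in> X))" if s: "s \<in> S" and i: "0 \<le> i" "i < m" for s i
  proof (cases "residue_subgroup m i s \<subseteq> B")
    case True
    have "delta y s \<in> B" if "y mod m = i" for y
    proof -
      have "delta y s \<in> residue_subgroup m i s"
        using s SA that generate.one[of A] generate.incl[of s "{s}" A]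
        by (auto simp: residue_subgroup_def) (auto simp: delta_def split: if_splits)
      then show ?thesis using True by blast
    qed
    then show ?thesis by (intro exI[of _ "{}"]) blast
  next
    case False
    then obtain u where u: "u \<in> B" "u \<in> residue_subgroup m i s" "u \<noteq> \<one>\<^bsub>N\<^esub>"
      using hit s i by blast
    have "s \<in> prime_order_elements A" using s S(2) by blast
    note window = delta_mem_if_window[OF this B(2) u]
    have "i mod m = i" using i by simp
    with window show ?thesis
      by (intro exI[of _ "{Min {x. u x \<noteq> \<one>}..<Max {x. u x \<noteq> \<one>}}"]) simp
  qed
  then obtain Y :: "'a \<Rightarrow> int \<Rightarrow> int set" where
    Yfin: "\<And>s i. s \<in> S \<Longrightarrow> 0 \<le> i \<Longrightarrow> i < m \<Longrightarrow> finite (Y s i)"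
    and Y: "\<And>s i X y. s \<in> S \<Longrightarrow> 0 \<le> i \<Longrightarrow> i < m \<Longrightarrow> subgroup X N \<Longrightarrow> B \<subseteq> X \<Longrightarrow>
      (\<forall>y\<in>Y s i. delta y s \<in> X) \<Longrightarrow> y mod m = i \<Longrightarrow> delta y s \<in> X"
    by metis
  define E where "E = (\<Union>s\<in>S. \<Union>i\<in>{0..<m}. (\<lambda>y. delta y s) ` Y s i)"
  have Efin: "finite E" using S(1) Yfin by (auto simp: E_def)
  have EN: "E \<subseteq> carrier N" using SA by (auto simp: E_def)
  have Etor: "\<exists>n>0. e [^]\<^bsub>N\<^esub> (n::nat) = \<one>\<^bsub>N\<^esub>" if e: "e \<in> E" for e
  proof -
    obtain s y where sy: "s \<in> S" "e = delta y s" using e by (auto simp: E_def)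
    then obtain p :: nat where p: "prime p" "s [^] p = \<one>"
      using S(2) by (auto simp: prime_order_elements_def)
    have "delta y s \<in> carrier N" using sy(1) SA by auto
    then have "e [^]\<^bsub>N\<^esub> p = \<one>\<^bsub>N\<^esub>"
      using sy(2) p(2) by (simp add: pow_N one_N) (simp add: delta_def fun_eq_iff)
    then show ?thesis using prime_gt_0_nat[OF p(1)] by blast
  qed
  define X where "X = generate N (B \<union> E)"
  have BE: "B \<union> E \<subseteq> carrier N" using EN subgroup.subset[OF B(1)] by blast
  have X: "subgroup X N" unfolding X_def by (rule N.generate_is_subgroup[OF BE])
  have BX: "B \<subseteq> X" "E \<subseteq> X" by (auto simp: X_def intro: generate.incl)
  have delta_X: "delta y s \<in> X" if "s \<in> S" for s y
  proof (rule Y[OF that _ _ X BX(1) _ refl])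
    show i: "0 \<le> y mod m" "y mod m < m" using m by simp_all
    show "\<forall>z\<in>Y s (y mod m). delta z s \<in> X"
    proof
      fix z assume "z \<in> Y s (y mod m)"
      then have "delta z s \<in> E" unfolding E_def using that i by (auto intro!: bexI[of _ s])
      then show "delta z s \<in> X" using BX(2) by blast
    qed
  qed
  have "carrier N \<subseteq> X"
  proof
    fix f assume f: "f \<in> carrier N"
    show "f \<in> X"
    proof (rule mem_subgroup_N[OF X f])
      fix x
      show "delta x (f x) \<in> X"
        using delta_generate_mem[OF X SA delta_X] S(3) f by simp
    qed
  qed
  moreover obtain F where "finite F" "F \<subseteq> carrier N"
    "\<forall>x\<in>generate N (B \<union> E). \<exists>b\<in>B. \<exists>\<phi>\<in>F. x = b \<otimes>\<^bsub>N\<^esub> \<phi>"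
    using N.generate_Un_finite_torsion[OF Efin EN Etor B(1)] by blast
  ultimately show ?thesis unfolding X_def by (intro exI[of _ F]) blast
qed

lemma N_apply:
  "\<one>\<^bsub>N\<^esub> x = \<one>"
  "(f \<otimes>\<^bsub>N\<^esub> g) x = f x \<otimes> g x"
  "f \<in> carrier N \<Longrightarrow> (inv\<^bsub>N\<^esub> f) x = inv (f x)"
  "shift k f x = f (x + k)"
  by (simp_all add: one_N mult_N inv_N shift_def)

lemma delta_apply: "delta x a y = (if y = x then a else \<one>)"
  by (simp add: delta_def)

lemma pow_W: "f \<in> carrier N \<Longrightarrow> (f, 0) [^]\<^bsub>W\<^esub> (n::nat) = (f [^]\<^bsub>N\<^esub> n, 0)"
  by (induction n) (auto simp: one_W mult_W)

section \<open>Necessity\<close>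

lemma power_in_square_powers_if_LR:
  assumes LR: "property_LR W" and a: "a \<in> carrier A"
  shows "\<exists>k::int. a [^] p = a [^] (int (p * p) * k)"
proof (cases "a [^] p = \<one>")
  case True
  then show ?thesis by (intro exI[of _ 0]) simp
next
  case False
  define b where "b = a [^] p"
  have b: "b \<in> carrier A" "b \<noteq> \<one>" using a False by (simp_all add: b_def)
  define H where "H = generate W {(delta 0 b, 0), (\<one>\<^bsub>N\<^esub>, 1)}"
  have gens: "{(delta 0 b, 0), (\<one>\<^bsub>N\<^esub>, 1)} \<subseteq> carrier W" using b by (simp add: carrier_W)
  have H: "subgroup H W" unfolding H_def by (rule W.generate_is_subgroup[OF gens])
  have "fin_gen_subgroup H W"
    unfolding fin_gen_subgroup_def H_def
    using gens by (intro exI[of _ "{(delta 0 b, 0), (\<one>\<^bsub>N\<^esub>, 1)}"]) simp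
  then have "virtual_retract H W" using LR H by (auto simp: property_LR_def)
  then obtain K \<rho> where K: "subgroup K W" "finite (rcosets\<^bsub>W\<^esub> K)" "H \<subseteq> K"
    and \<rho>: "\<rho> \<in> hom (W\<lparr>carrier := K\<rparr>) (W\<lparr>carrier := K, carrier := H\<rparr>)"
    and id: "\<And>h. h \<in> H \<Longrightarrow> \<rho> h = h"
    unfolding virtual_retract_def group_retract_def by blast
  have \<rho>_closed: "\<rho> x \<in> H" if "x \<in> K" for x using \<rho> that by (auto simp: hom_def)
  have \<rho>_mult: "\<rho> (x \<otimes>\<^bsub>W\<^esub> y) = \<rho> x \<otimes>\<^bsub>W\<^esub> \<rho> y" if "x \<in> K" "y \<in> K" for x y
    using \<rho> that by (auto simp: hom_def)

  have b0: "(delta 0 b, 0) \<in> H" and t1: "(\<one>\<^bsub>N\<^esub>, 1) \<in> H"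
    by (auto simp: H_def intro: generate.incl)
  have t: "(\<one>\<^bsub>N\<^esub>, k) \<in> H" for k
  proof (induction k rule: int_induct[of _ 0])
    case base
    show ?case using subgroup.one_closed[OF H] by (simp add: one_W)
  next
    case (step1 i)
    then show ?case using subgroup.m_closed[OF H step1(2) t1] by (simp add: mult_W)
  next
    case (step2 i)
    then show ?case using subgroup.m_closed[OF H step2(2) subgroup.m_inv_closed[OF H t1]]
      by (simp add: mult_W inv_W)
  qed
  have bj: "(delta j b, 0) \<in> H" for j
    using subgroup.m_closed[OF H subgroup.m_closed[OF H t[of "- j"] b0] t[of j]] b
    by (simp add: mult_W shift_delta)
  have "H \<subseteq> {(f, k). f \<in> carrier N \<and> (\<forall>x. f x \<in> generate A {b})}"
  proof -
    interpret b: subgroup "generate A {b}" A using b by (simp add: generate_is_subgroup)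
    have "subgroup {(f, k). f \<in> carrier N \<and> (\<forall>x. f x \<in> generate A {b})} W"
      by (rule W.subgroupI) (auto simp: carrier_W mult_W inv_W N_apply intro!: exI[of _ "\<one>\<^bsub>N\<^esub>"])
    then show ?thesis unfolding H_def
      by (rule W.generate_subgroup_incl[rotated])
        (use b in \<open>auto intro: generate.incl simp: N_apply delta_apply\<close>)
  qed
  then have Hval: "f x \<in> generate A {b}" if "(f, k) \<in> H" for f k x using that by blast

  \<comment> \<open>Pigeonhole: infinitely many translates of \<open>a\<close> are distributed over
    finitely many cosets of \<open>K\<close>.\<close>
  have "\<exists>i j :: nat. i \<noteq> j \<and> K #>\<^bsub>W\<^esub> (delta (int i) a, 0) = K #>\<^bsub>W\<^esub> (delta (int j) a, 0)"
  proof (rule ccontr)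
    assume "\<not> ?thesis"
    then have "inj (\<lambda>i::nat. K #>\<^bsub>W\<^esub> (delta (int i) a, 0))" by (auto simp: inj_def)
    moreover have "range (\<lambda>i::nat. K #>\<^bsub>W\<^esub> (delta (int i) a, 0)) \<subseteq> rcosets\<^bsub>W\<^esub> K"
      using a by (intro image_subsetI W.rcosetsI subgroup.subset[OF K(1)]) (simp add: carrier_W)
    ultimately show False
      using K(2) finite_subset finite_imageD[of _ "UNIV :: nat set"] infinite_UNIV_nat by blast
  qed
  then obtain i j :: nat where ij: "i \<noteq> j"
    and eq: "K #>\<^bsub>W\<^esub> (delta (int i) a, 0) = K #>\<^bsub>W\<^esub> (delta (int j) a, 0)" by blast
  define z where "z = delta (int i) a \<otimes>\<^bsub>N\<^esub> inv\<^bsub>N\<^esub> (delta (int j) a)"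
  have zN: "z \<in> carrier N" using a by (simp add: z_def)
  have zK: "(z, 0) \<in> K"
  proof -
    have "(delta (int i) a, 0) \<in> K #>\<^bsub>W\<^esub> (delta (int i) a, 0)"
      using a K(1) by (intro W.rcos_self) (simp_all add: carrier_W)
    then have "(delta (int i) a, 0) \<in> K #>\<^bsub>W\<^esub> (delta (int j) a, 0)" by (simp only: eq)
    then obtain f l where fl: "(f, l) \<in> K" "(delta (int i) a, 0) = (f, l) \<otimes>\<^bsub>W\<^esub> (delta (int j) a, 0)"
      unfolding r_coset_def by auto
    have "f \<in> carrier N" using fl(1) subgroup.mem_carrier[OF K(1)] carrier_W by auto
    then have "l = 0" "f = z" using fl(2) a by (auto simp: mult_W z_def N.inv_solve_right)
    then show ?thesis using fl(1) by simp
  qed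
  obtain g l where gl: "\<rho> (z, 0) = (g, l)" by (cases "\<rho> (z, 0)")
  have glH: "(g, l) \<in> H" using \<rho>_closed[OF zK] gl by simp
  have gN: "g \<in> carrier N" using glH subgroup.mem_carrier[OF H] carrier_W by auto
  \<comment> \<open>The base group is abelian, so \<open>(z, 0)\<close> commutes with
    \<open>(delta 0 b, 0)\<close>. The retraction fixes the latter, so the image of
    \<open>(z, 0)\<close> commutes with it too.\<close>
  have "(g, l) \<otimes>\<^bsub>W\<^esub> (delta 0 b, 0) = (delta 0 b, 0) \<otimes>\<^bsub>W\<^esub> (g, l)"
  proof -
    have "(z, 0) \<otimes>\<^bsub>W\<^esub> (delta 0 b, 0) = (delta 0 b, 0) \<otimes>\<^bsub>W\<^esub> (z, 0)"
      using zN b by (simp add: mult_W N.m_comm)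
    then have "\<rho> (z, 0) \<otimes>\<^bsub>W\<^esub> \<rho> (delta 0 b, 0) = \<rho> (delta 0 b, 0) \<otimes>\<^bsub>W\<^esub> \<rho> (z, 0)"
      using \<rho>_mult zK b0 K(3) by (metis subsetD)
    then show ?thesis using gl id[OF b0] by simp
  qed
  then have "g \<otimes>\<^bsub>N\<^esub> delta (- l) b = g \<otimes>\<^bsub>N\<^esub> delta 0 b"
    using gN b by (simp add: mult_W shift_delta N.m_comm)
  then have "delta (- l) b = delta 0 b" using gN b by simp
  then have "delta (- l) b 0 = delta 0 b 0" by simp
  \<comment> \<open>A non-zero translation would move the value \<open>b\<close> away from position
    0; this is where \<open>b\<close> has to be non-trivial.\<close>
  then have l: "l = 0" using b(2) by (auto simp: delta_def split: if_splits)
  have pow: "(z, 0) [^]\<^bsub>W\<^esub> n \<in> K \<and> \<rho> ((z, 0) [^]\<^bsub>W\<^esub> n) = (g, 0) [^]\<^bsub>W\<^esub> n" for n :: nat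
  proof (induction n)
    case 0
    show ?case using subgroup.one_closed[OF K(1)] subgroup.one_closed[OF H] id by simp
  next
    case (Suc n)
    then show ?case using subgroup.m_closed[OF K(1) _ zK] \<rho>_mult[OF _ zK] gl l by simp
  qed
  \<comment> \<open>Taking \<open>p\<close>-th powers turns \<open>a\<close> into \<open>b\<close>,
    so \<open>z^p\<close> lies in \<open>H\<close> and is fixed by the retraction. Hence
    \<open>g^p = z^p\<close>, and the coordinate at \<open>i\<close> exhibits \<open>a^p\<close> as
    the \<open>p\<close>-th power of a power of \<open>b\<close>.\<close>
  have "z [^]\<^bsub>N\<^esub> p = delta (int i) b \<otimes>\<^bsub>N\<^esub> inv\<^bsub>N\<^esub> (delta (int j) b)"
  proof
    fix x
    have "(z [^]\<^bsub>N\<^esub> p) x = (delta (int i) a x \<otimes> inv (delta (int j) a x)) [^] p"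
      using a zN by (simp add: pow_N) (simp add: z_def N_apply)
    also have "\<dots> = delta (int i) b x \<otimes> inv (delta (int j) b x)"
      using a ij by (auto simp: delta_apply b_def nat_pow_inv)
    finally show "(z [^]\<^bsub>N\<^esub> p) x = (delta (int i) b \<otimes>\<^bsub>N\<^esub> inv\<^bsub>N\<^esub> (delta (int j) b)) x"
      using b by (simp add: N_apply)
  qed
  moreover have "(\<dots>, 0) \<in> H"
    using subgroup.m_closed[OF H bj[of "int i"] subgroup.m_inv_closed[OF H bj[of "int j"]]] b
    by (simp add: mult_W inv_W)
  ultimately have "(z [^]\<^bsub>N\<^esub> p, 0) \<in> H" by simp
  then have "(g [^]\<^bsub>N\<^esub> p, 0) = (z [^]\<^bsub>N\<^esub> p, 0)"
    using pow[of p] id by (simp add: pow_W zN gN)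
  then have "g (int i) [^] p = z (int i) [^] p" using zN gN by (simp add: pow_N fun_eq_iff)
  also have "z (int i) = a" using ij a by (simp add: z_def N_apply delta_apply)
  finally have "g (int i) [^] p = a [^] p" .
  moreover obtain k :: int where "g (int i) = b [^] k"
    using Hval[OF glH, of "int i"] unfolding generate_pow[OF b(1)] by auto
  ultimately have "a [^] p = ((a [^] int p) [^] k) [^] int p" by (simp add: b_def int_pow_int)
  then have "a [^] p = a [^] (int (p * p) * k)" using a by (simp add: int_pow_pow ac_simps)
  then show ?thesis by blast
qed

section \<open>Sufficiency\<close>

lemma N_bounded_support:
  assumes "f \<in> carrier N"
  shows "\<exists>c. \<forall>x. c < \<bar>x\<bar> \<longrightarrow> f x = \<one>"
proof -
  have "bdd_above (abs ` {x. f x \<noteq> \<one>})" using assms by (simp add: mem_N_iff)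
  then obtain c where "\<And>x. f x \<noteq> \<one> \<Longrightarrow> \<bar>x\<bar> \<le> c" by (auto simp: bdd_above_def)
  then show ?thesis by (metis not_le)
qed

lemma subgroup_supported:
  "subgroup {(f, k). f \<in> carrier N \<and> (\<forall>x. c < \<bar>x\<bar> \<longrightarrow> f x = \<one>) \<and> k = (0::int)} W"
  by (rule W.subgroupI)
    (auto simp: carrier_W mult_W inv_W N_apply intro!: exI[of _ "\<one>\<^bsub>N\<^esub>"])

text \<open>The semidirect product of \<open>B\<close> with the multiples of \<open>m\<close>; the
  value \<open>m = 0\<close> yields the copy of \<open>B\<close> in the base group.\<close>

lemma subgroup_N_lift:
  assumes "subgroup B N" "\<And>f k. f \<in> B \<Longrightarrow> m dvd k \<Longrightarrow> shift k f \<in> B"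
  shows "subgroup {(f, k). f \<in> B \<and> m dvd k} W"
proof (rule W.subgroupI)
  interpret B: subgroup B N by fact
  show "{(f, k). f \<in> B \<and> m dvd k} \<noteq> {}" using B.one_closed by blast
  show "inv\<^bsub>W\<^esub> x \<in> {(f, k). f \<in> B \<and> m dvd k}" if "x \<in> {(f, k). f \<in> B \<and> m dvd k}" for x
    using that assms(2) by (auto simp: inv_W)
  show "x \<otimes>\<^bsub>W\<^esub> y \<in> {(f, k). f \<in> B \<and> m dvd k}"
    if "x \<in> {(f, k). f \<in> B \<and> m dvd k}" "y \<in> {(f, k). f \<in> B \<and> m dvd k}" for x y
    using that assms(2) by (auto simp: mult_W)
qed (auto simp: carrier_W dest: subgroup.mem_carrier[OF assms(1)])

text \<open>As the base group is abelian, conjugation by \<open>(h, k)\<close> acts on it through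
  \<open>k\<close> alone.\<close>

lemma conj_W:
  assumes "f \<in> carrier N" "h \<in> carrier N"
  shows "(h, k) \<otimes>\<^bsub>W\<^esub> (f, 0) \<otimes>\<^bsub>W\<^esub> inv\<^bsub>W\<^esub> (h, k) = (shift k f, 0)"
proof -
  have "(h, k) \<otimes>\<^bsub>W\<^esub> (f, 0) = (shift k f, 0) \<otimes>\<^bsub>W\<^esub> (h, k)"
    using assms by (simp add: mult_W N.m_comm)
  then show ?thesis using assms W.inv_solve_right'[of "(shift k f, 0)" "(h, k) \<otimes>\<^bsub>W\<^esub> (f, 0)" "(h, k)"]
    by (simp add: carrier_W mult_W)
qed

text \<open>The commutator of \<open>f\<close> with the translation by \<open>k\<close>; in module
  terms, the image of \<open>f\<close> under 1 minus the shift by \<open>k\<close>.\<close>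

definition coboundary :: "int \<Rightarrow> (int \<Rightarrow> 'a) \<Rightarrow> int \<Rightarrow> 'a"
  where "coboundary k f = f \<otimes>\<^bsub>N\<^esub> inv\<^bsub>N\<^esub> (shift k f)"

lemma coboundary_closed [simp]: "f \<in> carrier N \<Longrightarrow> coboundary k f \<in> carrier N"
  by (simp add: coboundary_def)

lemma coboundary_hom: "coboundary k \<in> hom N N"
  by (rule homI) (simp_all add: coboundary_def shift_mult N.inv_mult N.m_ac)

lemma coboundary_add:
  assumes "f \<in> carrier N"
  shows "coboundary (k + l) f = coboundary k f \<otimes>\<^bsub>N\<^esub> coboundary l (shift k f)"
proof -
  have "inv\<^bsub>N\<^esub> (shift k f) \<otimes>\<^bsub>N\<^esub> (shift k f \<otimes>\<^bsub>N\<^esub> inv\<^bsub>N\<^esub> (shift (k + l) f)) = inv\<^bsub>N\<^esub> (shift (k + l) f)"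
    using assms by (simp flip: N.m_assoc)
  then show ?thesis using assms by (simp add: coboundary_def N.m_assoc add.commute)
qed

text \<open>The module form of \<open>1 - x\<close> dividing \<open>1 - x^q\<close>. For
  \<open>q >= 0\<close> the sum telescopes by \<open>coboundary_add\<close>; a negative
  \<open>q\<close> reduces to \<open>- q\<close>, because the coboundaries for \<open>k\<close> and
  \<open>- k\<close> combine to the trivial one for 0.\<close>

lemma coboundary_multiple:
  assumes f: "f \<in> carrier N" and k: "m dvd k"
  shows "coboundary k f \<in> coboundary m ` carrier N"
proof -
  interpret c: group_hom N N "coboundary m"
    using coboundary_hom by (simp add: group_hom_def group_hom_axioms_def N.is_group)
  note img = c.img_is_subgroup
  have nat: "coboundary (m * int n) f \<in> coboundary m ` carrier N" if "f \<in> carrier N" for n f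
    using that
  proof (induction n)
    case 0
    then have "coboundary (m * int 0) f = \<one>\<^bsub>N\<^esub>" by (simp add: coboundary_def)
    then show ?case using subgroup.one_closed[OF img] by (simp only:)
  next
    case (Suc n)
    have "coboundary (m * int (Suc n)) f
        = coboundary (m * int n) f \<otimes>\<^bsub>N\<^esub> coboundary m (shift (m * int n) f)"
      using coboundary_add[OF Suc.prems, of "m * int n" m] by (simp add: algebra_simps)
    then show ?case using subgroup.m_closed[OF img] Suc by simp
  qed
  obtain q where q: "k = m * q" using k by blast
  show ?thesis
  proof (cases "q \<ge> 0")
    case True
    then show ?thesis using nat[OF f, of "nat q"] q by simp
  next
    case False
    have "\<one>\<^bsub>N\<^esub> = coboundary k f \<otimes>\<^bsub>N\<^esub> coboundary (- k) (shift k f)"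
      using coboundary_add[OF f, of k "- k"] f by (simp add: coboundary_def)
    then have "coboundary k f = inv\<^bsub>N\<^esub> (coboundary (- k) (shift k f))"
      using f by (intro N.inv_equality[symmetric]) (simp_all add: N.m_comm)
    moreover have "coboundary (- k) (shift k f) \<in> coboundary m ` carrier N"
      using nat[of "shift k f" "nat (- q)"] f q False by simp
    ultimately show ?thesis using subgroup.m_inv_closed[OF img] by simp
  qed
qed

text \<open>Along a residue class modulo \<open>m\<close>, a function whose coboundary is supported at a single
  point is constant on both sides of it, hence vanishes by finiteness of its support.\<close>

lemma coboundary_trivial:
  assumes g: "g \<in> carrier N" and m: "m > 2 * c"
    and supp: "\<And>x. c < \<bar>x\<bar> \<Longrightarrow> coboundary m g x = \<one>"
  shows "coboundary m g = \<one>\<^bsub>N\<^esub>"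
proof
  fix x
  have one: "\<one>\<^bsub>N\<^esub> x = \<one>" by (rule N_apply)
  show "coboundary m g x = \<one>\<^bsub>N\<^esub> x"
  proof (cases "c < \<bar>x\<bar>")
    case True
    then show ?thesis using supp one by simp
  next
    case False
    have m0: "m > 0" using m False by linarith
    have per: "g y = g (y + m)" if "c < \<bar>y\<bar>" for y
    proof -
      have "g y \<otimes> inv (g (y + m)) = \<one>" using supp[OF that] g by (simp add: coboundary_def N_apply)
      then show ?thesis using g by (metis N_closed inv_equality inv_inv inv_closed)
    qed
    \<comment> \<open>Since \<open>x\<close> has absolute value at most \<open>c\<close> and
      \<open>m > 2 * c\<close>, every other point of its residue class lies where the coboundary is
      trivial. So \<open>g\<close> is constant on \<open>x + m, x + 2 m, ...\<close> and on
      \<open>x, x - m, x - 2 m, ...\<close>.\<close>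
    have up: "g (x + m) = g (x + m + m * int n)" for n
    proof (induction n)
      case (Suc n)
      have "c < \<bar>x + m + m * int n\<bar>"
        using False m m0 mult_nonneg_nonneg[of m "int n"] by linarith
      then show ?case using Suc per[of "x + m + m * int n"] by (simp add: algebra_simps)
    qed simp
    have down: "g x = g (x - m * int n)" for n
    proof (induction n)
      case (Suc n)
      have "c < \<bar>x - m * int n - m\<bar>"
        using False m m0 mult_nonneg_nonneg[of m "int n"] by linarith
      then show ?case using Suc per[of "x - m * int n - m"] by (simp add: algebra_simps)
    qed simp
    obtain d where d: "\<And>y. d < \<bar>y\<bar> \<Longrightarrow> g y = \<one>" using N_bounded_support[OF g] by blast
    define n where "n = nat (\<bar>d\<bar> + \<bar>x\<bar> + 1)"
    have "m * int n \<ge> \<bar>d\<bar> + \<bar>x\<bar> + 1"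
      using m0 mult_right_mono[of 1 m "int n"] by (simp add: n_def)
    then have "d < \<bar>x + m + m * int n\<bar>" "d < \<bar>x - m * int n\<bar>" using m0 by linarith+
    then have "g (x + m) = \<one>" "g x = \<one>" using d up[of n] down[of n] by metis+
    then show ?thesis using g by (simp add: coboundary_def N_apply)
  qed
qed

section \<open>Subgroups of the base group with bounded support\<close>

lemma virtual_retract_in_base:
  assumes S: "finite S" "S \<subseteq> prime_order_elements A" "generate A S = carrier A"
    and H: "subgroup H W" and supp: "\<And>f k x. (f, k) \<in> H \<Longrightarrow> k = 0 \<and> (c < \<bar>x\<bar> \<longrightarrow> f x = \<one>)"
  shows "virtual_retract H W"
proof -
  \<comment> \<open>The absolute value keeps \<open>m\<close> positive even for negative
    \<open>c\<close>; \<open>m > 2 * c\<close> is the bound that \<open>coboundary_trivial\<close>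
    asks for.\<close>
  define m where "m = 2 * \<bar>c\<bar> + 1"
  have m: "m > 0" "m > 2 * c" by (simp_all add: m_def)
  define B where "B = coboundary m ` carrier N"
  interpret c: group_hom N N "coboundary m"
    using coboundary_hom by (simp add: group_hom_def group_hom_axioms_def N.is_group)
  have B: "subgroup B N" unfolding B_def by (rule c.img_is_subgroup)
  have Bshift: "shift k f \<in> B" if f: "f \<in> B" for f k
  proof -
    obtain g where g: "g \<in> carrier N" "f = coboundary m g" using f by (auto simp: B_def)
    then have "shift k f = coboundary m (shift k g)"
      by (simp add: coboundary_def shift_mult shift_inv add.commute)
    then show ?thesis using g by (simp add: B_def)
  qed
  have hit: "residue_subgroup m i s \<subseteq> B \<or> (\<exists>u\<in>B. u \<in> residue_subgroup m i s \<and> u \<noteq> \<one>\<^bsub>N\<^esub>)"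
    if s: "s \<in> S" for i s
  \<comment> \<open>A generator may be the identity, and then its residue subgroups are
    trivial.\<close>
  proof (cases "s = \<one>")
    case True
    have "residue_subgroup m i s \<subseteq> {\<one>\<^bsub>N\<^esub>}"
      unfolding residue_subgroup_def True generate_one by (auto simp: one_N)
    then show ?thesis using subgroup.one_closed[OF B] by blast
  next
    case False
    have sA: "s \<in> carrier A" using s S(2) prime_order_elements_subset[of A] by blast
    have R: "subgroup (residue_subgroup m i s) N" using sA by (rule subgroup_residue_subgroup)
    have "delta i s \<in> residue_subgroup m i s"
      using sA generate.one[of A] generate.incl[of s "{s}" A]
      by (auto simp: residue_subgroup_def delta_apply)
    then have "coboundary m (delta i s) \<in> residue_subgroup m i s"
      unfolding coboundary_def using shift_residue_subgroup
      by (intro subgroup.m_closed[OF R] subgroup.m_inv_closed[OF R]) auto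
    moreover have "coboundary m (delta i s) i \<noteq> \<one>"
      using sA False m by (simp add: coboundary_def N_apply delta_apply)
    moreover have "coboundary m (delta i s) \<in> B" using sA by (simp add: B_def)
    ultimately show ?thesis using N_apply(1) by metis
  qed
  obtain F where F: "finite F" "F \<subseteq> carrier N"
    and cov: "\<And>f. f \<in> carrier N \<Longrightarrow> \<exists>b\<in>B. \<exists>\<phi>\<in>F. f = b \<otimes>\<^bsub>N\<^esub> \<phi>"
    using finite_transversal[OF m(1) S B Bshift hit] by blast
  define L where "L = {(f, k). f \<in> B \<and> m dvd k}"
  show ?thesis
  proof (rule W.virtual_retract_if_normalised_complement[OF H])
    show "subgroup L W" unfolding L_def using B Bshift by (rule subgroup_N_lift)
    show "h \<otimes>\<^bsub>W\<^esub> l \<otimes>\<^bsub>W\<^esub> inv\<^bsub>W\<^esub> h \<in> L" if hl: "h \<in> H" "l \<in> L" for h l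
    proof -
      obtain h0 where h: "h = (h0, 0)" using supp hl(1) by (cases h) blast
      obtain f k where l: "l = (f, k)" "f \<in> B" "m dvd k" using hl(2) by (auto simp: L_def)
      have h0: "h0 \<in> carrier N" using subgroup.mem_carrier[OF H hl(1)] by (simp add: h carrier_W)
      have f: "f \<in> carrier N" using subgroup.mem_carrier[OF B l(2)] .
      \<comment> \<open>Conjugation by a base element multiplies \<open>f\<close> by a coboundary
        for \<open>k\<close>. Since \<open>m\<close> divides \<open>k\<close>, this lies in
        \<open>B\<close>, which is why \<open>L\<close> is built from coboundaries.\<close>
      have "h \<otimes>\<^bsub>W\<^esub> l \<otimes>\<^bsub>W\<^esub> inv\<^bsub>W\<^esub> h = (f \<otimes>\<^bsub>N\<^esub> coboundary k h0, k)"
        using h0 f by (simp add: h l(1) mult_W inv_W shift_inv coboundary_def N.m_ac)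
      moreover have "coboundary k h0 \<in> B" unfolding B_def using h0 l(3) by (rule coboundary_multiple)
      ultimately show ?thesis using l subgroup.m_closed[OF B] by (simp add: L_def)
    qed
    show "H \<inter> L \<subseteq> {\<one>\<^bsub>W\<^esub>}"
    proof
      fix x assume x: "x \<in> H \<inter> L"
      then obtain f where f: "x = (f, 0)" "f \<in> B" using supp by (cases x) (auto simp: L_def)
      then obtain g where g: "g \<in> carrier N" "f = coboundary m g" by (auto simp: B_def)
      have "f = \<one>\<^bsub>N\<^esub>" unfolding g(2)
        by (rule coboundary_trivial[OF g(1) m(2)]) (use supp x f g in blast)
      then show "x \<in> {\<one>\<^bsub>W\<^esub>}" using f by (simp add: one_W)
    qed
    show "finite (F \<times> {0..<m})" "F \<times> {0..<m} \<subseteq> carrier W"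
      using F by (auto simp: carrier_W)
    fix x assume "x \<in> carrier W"
    then obtain f k where x: "x = (f, k)" "f \<in> carrier N" by (auto simp: carrier_W)
    \<comment> \<open>The translation by \<open>q\<close> stands to the left of the representative,
      so the covering is applied to \<open>f\<close> shifted back by \<open>q\<close>.\<close>
    define q where "q = m * (k div m)"
    obtain b \<phi> where b: "b \<in> B" "\<phi> \<in> F" "shift (- q) f = b \<otimes>\<^bsub>N\<^esub> \<phi>"
      using cov[of "shift (- q) f"] x by auto
    have bN: "b \<in> carrier N" using subgroup.mem_carrier[OF B b(1)] .
    have "f = shift q (shift (- q) f)" by simp
    then have f: "f = shift q b \<otimes>\<^bsub>N\<^esub> shift q \<phi>" using b(3) by (simp only: shift_mult)
    have "q + k mod m = k" by (simp add: q_def)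
    then have "x = (\<one>\<^bsub>N\<^esub>, 0) \<otimes>\<^bsub>W\<^esub> (shift q b, q) \<otimes>\<^bsub>W\<^esub> (\<phi>, k mod m)"
      using bN by (simp add: x(1) f mult_W)
    moreover have "(\<one>\<^bsub>N\<^esub>, 0) \<in> H" using subgroup.one_closed[OF H] by (simp add: one_W)
    moreover have "(shift q b, q) \<in> L" using Bshift[OF b(1)] by (simp add: L_def q_def)
    moreover have "(\<phi>, k mod m) \<in> F \<times> {0..<m}" using b m by simp
    ultimately show "\<exists>h\<in>H. \<exists>l\<in>L. \<exists>f\<in>F \<times> {0..<m}. x = h \<otimes>\<^bsub>W\<^esub> l \<otimes>\<^bsub>W\<^esub> f" by blast
  qed
qed

section \<open>Subgroups with non-trivial projection to the integers\<close>

lemma virtual_retract_not_in_base: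
  assumes S: "finite S" "S \<subseteq> prime_order_elements A" "generate A S = carrier A"
    and H: "subgroup H W" and nz: "(f1, k1) \<in> H" "k1 \<noteq> 0"
  shows "virtual_retract H W"
proof -
  have SA: "S \<subseteq> carrier A" using S(2) prime_order_elements_subset by (rule order_trans)
  have HN: "f \<in> carrier N" if "(f, k) \<in> H" for f k
    using subgroup.mem_carrier[OF H that] by (simp add: carrier_W)
  \<comment> \<open>The projection of \<open>H\<close> to the integers; it will be the set of
    multiples of its least positive element \<open>m\<close>.\<close>
  define D where "D = snd ` H"
  have D0: "0 \<in> D" using subgroup.one_closed[OF H] by (force simp: D_def one_W)
  have Dadd: "k + l \<in> D" if "k \<in> D" "l \<in> D" for k l
    using that subgroup.m_closed[OF H] by (force simp: D_def mult_W)
  have Dneg: "- k \<in> D" if k: "k \<in> D" for k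
  proof -
    obtain f where "(f, k) \<in> H" using k by (auto simp: D_def)
    then show ?thesis using subgroup.m_inv_closed[OF H, of "(f, k)"] HN by (force simp: D_def inv_W)
  qed
  have "\<exists>n::nat. n > 0 \<and> int n \<in> D"
  proof -
    have "k1 \<in> D" "- k1 \<in> D" using nz(1) Dneg by (force simp: D_def)+
    then have "int (nat \<bar>k1\<bar>) \<in> D" by (simp add: abs_if)
    then show ?thesis using nz(2) by (intro exI[of _ "nat \<bar>k1\<bar>"]) simp
  qed
  then obtain n :: nat where n: "n > 0" "int n \<in> D"
    and least: "\<forall>n'<n. \<not> (0 < n' \<and> int n' \<in> D)"
    unfolding exists_least_iff[of "\<lambda>n. 0 < n \<and> int n \<in> D"] by blast
  define m where "m = int n"
  have m: "m > 0" using n by (simp add: m_def)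
  have Dmult: "m * q \<in> D" for q
  proof (induction q rule: int_induct[of _ 0])
    case (step1 i)
    then show ?case using Dadd[of "m * i" m] n by (simp add: m_def algebra_simps)
  next
    case (step2 i)
    then show ?case using Dadd[of "m * i" "- m"] Dneg[of m] n by (simp add: m_def algebra_simps)
  qed (use D0 in simp)
  have Ddvd: "m dvd k" if k: "k \<in> D" for k
  proof -
    have "k mod m = k + m * (- (k div m))" by (simp add: minus_mult_div_eq_mod[symmetric])
    then have "k mod m \<in> D" using Dadd[OF k Dmult[of "- (k div m)"]] by (simp only:)
    then have "int (nat (k mod m)) \<in> D" using m by simp
    moreover have "nat (k mod m) < n" using m by (simp add: m_def nat_less_iff)
    ultimately have "\<not> 0 < nat (k mod m)" using least[THEN spec, of "nat (k mod m)"] by iprover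
    then have "k mod m = 0" using m pos_mod_sign[of m k] by linarith
    then show ?thesis by blast
  qed
  define M where "M = {f. (f, 0) \<in> H}"
  have M: "subgroup M N"
  proof (rule N.subgroupI)
    show "M \<subseteq> carrier N" using HN by (auto simp: M_def)
    show "M \<noteq> {}" using subgroup.one_closed[OF H] by (auto simp: M_def one_W)
    show "inv\<^bsub>N\<^esub> f \<in> M" if "f \<in> M" for f
      using that subgroup.m_inv_closed[OF H, of "(f, 0)"] HN[of f 0] by (simp add: M_def inv_W)
    show "f \<otimes>\<^bsub>N\<^esub> g \<in> M" if "f \<in> M" "g \<in> M" for f g
      using that subgroup.m_closed[OF H, of "(f, 0)" "(g, 0)"] by (simp add: M_def mult_W)
  qed
  \<comment> \<open>An element of \<open>H\<close> over \<open>k\<close> conjugates the base group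
    by the shift by \<open>k\<close>, and this conjugation preserves both \<open>H\<close> and the
    base group.\<close>
  have Mshift: "shift k f \<in> M" if f: "f \<in> M" and k: "m dvd k" for f k
  proof -
    obtain h where h: "(h, k) \<in> H" using Dmult k by (force simp: D_def dvd_def)
    have "(h, k) \<otimes>\<^bsub>W\<^esub> (f, 0) \<otimes>\<^bsub>W\<^esub> inv\<^bsub>W\<^esub> (h, k) \<in> H"
      using f h by (intro subgroup.m_closed[OF H] subgroup.m_inv_closed[OF H]) (simp_all add: M_def)
    then show ?thesis using conj_W[of f h k] HN[OF h] f HN[of f 0] by (simp add: M_def)
  qed

  define I where "I = {0..<m} \<times> S"
  define X where "X J = (\<Union>(i, s)\<in>J. residue_subgroup m i s)" for J
  have XN: "X J \<subseteq> carrier N" for J by (auto simp: X_def residue_subgroup_def)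
  \<comment> \<open>The sets of residue modules whose joint span meets \<open>M\<close> trivially.
    There are finitely many, so a maximal one exists; its span \<open>M'\<close> becomes the
    complement.\<close>
  define good where "good = {J. J \<subseteq> I \<and> generate N (X J) \<inter> M \<subseteq> {\<one>\<^bsub>N\<^esub>}}"
  have "finite good" unfolding good_def
    by (rule finite_subset[of _ "Pow I"]) (use S(1) in \<open>auto simp: I_def\<close>)
  moreover have "{} \<in> good" by (auto simp: good_def X_def N.generate_empty)
  ultimately obtain J where "J \<in> good" and max: "\<And>J'. J' \<in> good \<Longrightarrow> J \<subseteq> J' \<Longrightarrow> J = J'"
    using finite_has_maximal[of good] by (metis empty_iff)
  then have J: "J \<subseteq> I" "generate N (X J) \<inter> M \<subseteq> {\<one>\<^bsub>N\<^esub>}" by (simp_all add: good_def)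
  define M' where "M' = generate N (X J)"
  have M': "subgroup M' N" unfolding M'_def by (rule N.generate_is_subgroup[OF XN])
  have M'shift: "shift k f \<in> M'" if f: "f \<in> M'" and k: "m dvd k" for f k
  proof -
    have "subgroup {f \<in> carrier N. shift k f \<in> M'} N"
      by (rule N.subgroupI)
        (auto simp: shift_mult shift_inv subgroup.m_closed[OF M'] subgroup.m_inv_closed[OF M']
          subgroup.one_closed[OF M'] intro!: exI[of _ "\<one>\<^bsub>N\<^esub>"])
    moreover have "X J \<subseteq> {f \<in> carrier N. shift k f \<in> M'}"
    proof
      fix f assume f: "f \<in> X J"
      then have "shift k f \<in> X J" unfolding X_def using shift_residue_subgroup[OF _ k] by blast
      then show "f \<in> {f \<in> carrier N. shift k f \<in> M'}"
        using f XN by (auto simp: M'_def intro: generate.incl)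
    qed
    ultimately have "M' \<subseteq> {f \<in> carrier N. shift k f \<in> M'}"
      unfolding M'_def by (intro N.generate_subgroup_incl)
    then show ?thesis using f by blast
  qed
  define B where "B = M <#>\<^bsub>N\<^esub> M'"
  have B: "subgroup B N" unfolding B_def using M M' by (rule N.mult_subgroups)
  have BI: "f \<otimes>\<^bsub>N\<^esub> g \<in> B" if "f \<in> M" "g \<in> M'" for f g
    using that by (auto simp: B_def set_mult_def)
  have BE: "\<exists>g\<in>M. \<exists>h\<in>M'. f = g \<otimes>\<^bsub>N\<^esub> h" if "f \<in> B" for f
    using that by (auto simp: B_def set_mult_def)
  have MB: "M \<subseteq> B"
    using BI[OF _ subgroup.one_closed[OF M']] subgroup.mem_carrier[OF M] by (force)
  have M'B: "M' \<subseteq> B"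
    using BI[OF subgroup.one_closed[OF M]] subgroup.mem_carrier[OF M'] by (force)
  have Bshift: "shift k f \<in> B" if f: "f \<in> B" and k: "m dvd k" for f k
  proof -
    obtain g h where "g \<in> M" "h \<in> M'" "f = g \<otimes>\<^bsub>N\<^esub> h" using BE[OF f] by blast
    then show ?thesis using BI Mshift[OF _ k] M'shift[OF _ k] by (simp add: shift_mult)
  qed
  have hit: "residue_subgroup m i s \<subseteq> B \<or> (\<exists>u\<in>B. u \<in> residue_subgroup m i s \<and> u \<noteq> \<one>\<^bsub>N\<^esub>)"
    if s: "s \<in> S" and i: "0 \<le> i" "i < m" for i s
  proof (cases "(i, s) \<in> J")
    case True
    then have "residue_subgroup m i s \<subseteq> M'" by (auto simp: M'_def X_def intro!: generate.incl)
    then show ?thesis using M'B by blast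
  next
    case False
    let ?J = "insert (i, s) J"
    have "?J \<subseteq> I" using J(1) s i by (simp add: I_def)
    \<comment> \<open>By maximality, adding the module at \<open>(i, s)\<close> produces a
      non-trivial \<open>y\<close> in \<open>M\<close>. Splitting \<open>y = w u\<close> with
      \<open>w\<close> in \<open>M'\<close> leaves a \<open>u\<close> in \<open>B\<close>,
      non-trivial because otherwise \<open>y\<close> would lie in both \<open>M\<close> and
      \<open>M'\<close>.\<close>
    then have "\<not> generate N (X ?J) \<inter> M \<subseteq> {\<one>\<^bsub>N\<^esub>}" using max[of ?J] False unfolding good_def by blast
    then obtain y where y: "y \<in> generate N (X ?J)" "y \<in> M" "y \<noteq> \<one>\<^bsub>N\<^esub>" by blast
    have "X ?J = X J \<union> residue_subgroup m i s" by (auto simp: X_def)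
    then have "y \<in> generate N (X J \<union> residue_subgroup m i s)" using y(1) by simp
    moreover have "subgroup (residue_subgroup m i s) N"
      using SA s by (intro subgroup_residue_subgroup) blast
    ultimately have "\<exists>w\<in>M'. \<exists>u\<in>residue_subgroup m i s. y = w \<otimes>\<^bsub>N\<^esub> u"
      unfolding M'_def by (intro N.generate_Un_subgroup[OF XN])
    then obtain w u where wu: "w \<in> M'" "u \<in> residue_subgroup m i s" "y = w \<otimes>\<^bsub>N\<^esub> u" by blast
    have wN: "w \<in> carrier N" using subgroup.mem_carrier[OF M' wu(1)] .
    have uN: "u \<in> carrier N" using wu(2) by (simp add: residue_subgroup_def)
    have "u \<noteq> \<one>\<^bsub>N\<^esub>"
    proof
      assume "u = \<one>\<^bsub>N\<^esub>"
      then have "y = w" using wu(3) wN by simp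
      then show False using wu(1) y J(2) by (auto simp: M'_def)
    qed
    moreover have "u = inv\<^bsub>N\<^esub> w \<otimes>\<^bsub>N\<^esub> y"
      using wN uN wu(3) by (simp flip: N.m_assoc)
    then have "u \<in> B"
      using subgroup.m_closed[OF B] subgroup.m_inv_closed[OF B] MB M'B y(2) wu(1) by blast
    ultimately show ?thesis using wu(2) by blast
  qed
  obtain F where F: "finite F" "F \<subseteq> carrier N"
    and cov: "\<And>f. f \<in> carrier N \<Longrightarrow> \<exists>b\<in>B. \<exists>\<phi>\<in>F. f = b \<otimes>\<^bsub>N\<^esub> \<phi>"
    using finite_transversal[OF m S B Bshift hit] by blast
  \<comment> \<open>\<open>0 dvd k\<close> says \<open>k = 0\<close>; this form makes
    \<open>L\<close> an instance of \<open>subgroup_N_lift\<close>.\<close>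
  define L where "L = {(f, k). f \<in> M' \<and> (0::int) dvd k}"
  show ?thesis
  proof (rule W.virtual_retract_if_normalised_complement[OF H])
    show "subgroup L W" unfolding L_def using M' by (rule subgroup_N_lift) (simp add: M'shift)
    show "h \<otimes>\<^bsub>W\<^esub> l \<otimes>\<^bsub>W\<^esub> inv\<^bsub>W\<^esub> h \<in> L" if hl: "h \<in> H" "l \<in> L" for h l
    proof -
      obtain h0 k where h: "h = (h0, k)" by (cases h)
      obtain f where l: "l = (f, 0)" "f \<in> M'" using hl(2) by (auto simp: L_def)
      have "m dvd k" using Ddvd hl(1) h by (force simp: D_def)
      then show ?thesis using conj_W[of f h0 k] HN[of h0 k] hl(1) l M'shift
          subgroup.mem_carrier[OF M' l(2)] by (simp add: h L_def)
    qed
    show "H \<inter> L \<subseteq> {\<one>\<^bsub>W\<^esub>}" using J(2) by (auto simp: L_def M'_def M_def one_W)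
    show "finite (F \<times> {0..<m})" "F \<times> {0..<m} \<subseteq> carrier W"
      using F by (auto simp: carrier_W)
    fix x assume xW: "x \<in> carrier W"
    then obtain f k where x: "x = (f, k)" "f \<in> carrier N" by (auto simp: carrier_W)
    \<comment> \<open>An element \<open>h\<close> of \<open>H\<close> over
      \<open>m * (k div m)\<close> reduces the translation part of \<open>x\<close> to
      \<open>k mod m\<close>. The factor of the remaining base element that lies in \<open>M\<close>
      is then absorbed into \<open>H\<close>.\<close>
    obtain f0 where f0: "(f0, m * (k div m)) \<in> H" using Dmult[of "k div m"] by (auto simp: D_def)
    define h where "h = (f0, m * (k div m))"
    have hH: "h \<in> H" and hW: "h \<in> carrier W"
      using f0 HN[OF f0] by (simp_all add: h_def carrier_W)
    have "snd (inv\<^bsub>W\<^esub> h \<otimes>\<^bsub>W\<^esub> x) = k mod m"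
      using HN[OF f0] by (simp add: h_def x inv_W mult_W minus_mult_div_eq_mod[symmetric])
    then obtain f' where f': "inv\<^bsub>W\<^esub> h \<otimes>\<^bsub>W\<^esub> x = (f', k mod m)" by (metis prod.collapse)
    have "f' \<in> carrier N"
      using W.m_closed[OF W.inv_closed[OF hW] xW] unfolding f' by (simp add: carrier_W)
    then obtain b \<phi> where b: "b \<in> B" "\<phi> \<in> F" "f' = b \<otimes>\<^bsub>N\<^esub> \<phi>" using cov by blast
    obtain g g' where g: "g \<in> M" "g' \<in> M'" "b = g \<otimes>\<^bsub>N\<^esub> g'" using BE[OF b(1)] by blast
    have gW: "(g, 0) \<in> carrier W" "(g', 0) \<in> carrier W" "(\<phi>, k mod m) \<in> carrier W"
      using subgroup.mem_carrier[OF M g(1)] subgroup.mem_carrier[OF M' g(2)] b(2) F(2)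
      by (auto simp: carrier_W)
    have "x = h \<otimes>\<^bsub>W\<^esub> (f', k mod m)"
      using xW hW unfolding f'[symmetric] by (simp flip: W.m_assoc)
    also have "(f', k mod m) = (g, 0) \<otimes>\<^bsub>W\<^esub> (g', 0) \<otimes>\<^bsub>W\<^esub> (\<phi>, k mod m)"
      by (simp add: mult_W b(3) g(3))
    also have "h \<otimes>\<^bsub>W\<^esub> \<dots> = (h \<otimes>\<^bsub>W\<^esub> (g, 0)) \<otimes>\<^bsub>W\<^esub> (g', 0) \<otimes>\<^bsub>W\<^esub> (\<phi>, k mod m)"
      using hW gW by (simp add: W.m_assoc)
    finally have "x = (h \<otimes>\<^bsub>W\<^esub> (g, 0)) \<otimes>\<^bsub>W\<^esub> (g', 0) \<otimes>\<^bsub>W\<^esub> (\<phi>, k mod m)" .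
    moreover have "h \<otimes>\<^bsub>W\<^esub> (g, 0) \<in> H" using hH g(1) subgroup.m_closed[OF H] by (simp add: M_def)
    moreover have "(g', 0) \<in> L" using g(2) by (simp add: L_def)
    moreover have "(\<phi>, k mod m) \<in> F \<times> {0..<m}" using b(2) m by simp
    ultimately show "\<exists>h\<in>H. \<exists>l\<in>L. \<exists>f\<in>F \<times> {0..<m}. x = h \<otimes>\<^bsub>W\<^esub> l \<otimes>\<^bsub>W\<^esub> f" by blast
  qed
qed

text \<open>For \<open>H\<close> inside the base group, finite generation gives a common bound for
  the supports of all elements of \<open>H\<close>, as \<open>virtual_retract_in_base\<close>
  requires.\<close>

lemma property_LR_if_prime_generated:
  assumes "prime_generated A"
  shows "property_LR W"
  unfolding property_LR_def
proof (intro conjI allI impI)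
  show "group W" by (rule W.is_group)
  obtain S where S: "finite S" "S \<subseteq> prime_order_elements A" "generate A S = carrier A"
    using assms by (auto simp: prime_generated_def)
  fix H assume "subgroup H W \<and> fin_gen_subgroup H W"
  then obtain T where H: "subgroup H W" and T: "finite T" "T \<subseteq> carrier W" "H = generate W T"
    by (auto simp: fin_gen_subgroup_def)
  show "virtual_retract H W"
  proof (cases "\<exists>f k. (f, k) \<in> H \<and> k \<noteq> 0")
    case True
    then show ?thesis using virtual_retract_not_in_base[OF S H] by blast
  next
    case False
    have "\<exists>c. \<forall>x. c < \<bar>x\<bar> \<longrightarrow> fst t x = \<one>" if "t \<in> T" for t
    proof -
      have "fst t \<in> carrier N" using T(2) that by (auto simp: carrier_W)
      then show ?thesis by (rule N_bounded_support)
    qed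
    then obtain c where c: "\<And>t x. t \<in> T \<Longrightarrow> c t < \<bar>x\<bar> \<Longrightarrow> fst t x = \<one>" by metis
    define d where "d = (\<Sum>t\<in>T. \<bar>c t\<bar>)"
    have d: "c t \<le> d" if "t \<in> T" for t
      using member_le_sum[of t T "\<lambda>t. \<bar>c t\<bar>"] that T(1) unfolding d_def by simp
    let ?Y = "{(f, k). f \<in> carrier N \<and> (\<forall>x. d < \<bar>x\<bar> \<longrightarrow> f x = \<one>) \<and> k = (0::int)}"
    have "T \<subseteq> ?Y"
    proof
      fix t assume t: "t \<in> T"
      then have "t \<in> H" using T(3) by (simp add: generate.incl)
      then have "snd t = 0" using False by (metis prod.collapse)
      then show "t \<in> ?Y" using c[OF t] d[OF t] t T(2) by (force simp: carrier_W)
    qed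
    then have "H \<subseteq> ?Y"
      unfolding T(3) by (rule W.generate_subgroup_incl) (rule subgroup_supported)
    then show ?thesis by (intro virtual_retract_in_base[OF S H, of d]) blast
  qed
qed

end

theorem theorem9p7:
  fixes A :: "('a, 'b) monoid_scheme"
  assumes "comm_group A" and "fin_gen_group A"
  shows "property_LR (restricted_wreath A integer_group) \<longleftrightarrow> semisimple_group A"
proof -
  interpret wreath_int A using assms(1) by (rule wreath_int.intro)
  show ?thesis
  proof
    assume "property_LR W"
    then have "prime_generated A"
      using power_in_square_powers_if_LR by (intro prime_generated_if_powers[OF assms(2)])
    then show "semisimple_group A" by (rule semisimple_if_prime_generated)
  next
    assume "semisimple_group A"
    then have "prime_generated A" by (rule prime_generated_if_semisimple[OF assms(2)])
    then show "property_LR W" by (rule property_LR_if_prime_generated)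
  qed
qed

end
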